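(* If $p\in(1,\infty)$ and $q\in[1,\infty]$, then the space $L^{p,q}(0,1)$ is sub-diagonal if and only if it is uniformly sub-diagonal, which is the case if and only if $q\le p$.
   Context: All spaces consist of measurable functions on $(0,1)$ with Lebesgue measure; $f^*(t)=\inf\{\lambda\ge0:|\{|f|>\lambda\}|\le t\}$. $L^{p,q}(0,1)$ is the set of $f$ with $\|f\|_{p,q}<\infty$, where $\|f\|_{p,q}=\left(\int_0^\infty[t^{1/p}f^*(t)]^q\frac{dt}t\right)^{1/q}$ for $q<\infty$ and $\|f\|_{p,\infty}=\sup_{t>0}t^{1/p}f^*(t)$; for $p\in(1,\infty)$, $q\in[1,\infty]$ it is an r.i. space up to equivalent renorming. A Young function is a convex, left-continuous $A:[0,\infty]\to[0,\infty]$ with $A(0)=0$, not identically zero or infinity on $(0,\infty]$. $L^A$ is the set of $f$ with $\|f\|_{L^A}=\inf\{\lambda>0:\int_0^1A(|f|/\lambda)\le1\}<\infty$. $X\hookrightarrow Y$ means $\|f\|_Y\le C\|f\|_X$ for all $f\in X$ with some $C>0$. $X\overset{*}{\hookrightarrow}Y$ (almost-compact embedding) means that for every sequence $\{E_n\}$ of measurable sets with $\chi_{E_n}\to0$ a.e. one has $\lim_{n\to\infty}\sup_{\|f\|_X\le1}\|f\chi_{E_n}\|_Y=0$. $X$ is sub-diagonal if $X=\bigcup\{L^A:A\text{ Young},\ L^A\hookrightarrow X\}$, and uniformly sub-diagonal if $X=\bigcup\{L^A:A\text{ Young},\ L^A\overset{*}{\hookrightarrow}X\}$. *)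

theory Defs
  imports "HOL-Analysis.Analysis"
begin

text \<open>
  Functions on $(0,1)$ are represented by total functions on the reals of which only the values
  on $(0,1)$ matter, and a function space by the functional (with values in $[0,\infty]$) that
  defines it: the space consists of the measurable functions at which the functional is finite.
  Functions are not identified when they agree almost everywhere; all functionals below are
  invariant under almost everywhere equality.
\<close>

abbreviation unit_leb :: "real measure" where
  "unit_leb \<equiv> lebesgue_on {0<..<1}"

type_synonym fnorm = "(real \<Rightarrow> real) \<Rightarrow> ennreal"

definition fspace :: "fnorm \<Rightarrow> (real \<Rightarrow> real) set" where
  "fspace N = {f \<in> borel_measurable unit_leb. N f < \<infinity>}"

text \<open>Real powers on $[0,\infty]$, only used with exponent \<open>a > 0\<close>.\<close>

definition epowr :: "ennreal \<Rightarrow> real \<Rightarrow> ennreal" where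
  "epowr x a = (if x = \<infinity> then \<infinity> else ennreal (enn2real x powr a))"

definition rearr :: "(real \<Rightarrow> real) \<Rightarrow> real \<Rightarrow> ennreal" where
  "rearr f t = Inf (ennreal ` {l. 0 \<le> l \<and>
     emeasure unit_leb {x \<in> space unit_leb. \<bar>f x\<bar> > l} \<le> ennreal t})"

definition lorentz :: "real \<Rightarrow> ennreal \<Rightarrow> fnorm" where
  "lorentz p q f =
     (if q = \<infinity> then (SUP t\<in>{0<..}. ennreal (t powr (1 / p)) * rearr f t)
      else epowr (\<integral>\<^sup>+t\<in>{0<..}. epowr (ennreal (t powr (1 / p)) * rearr f t) (enn2real q) / ennreal t \<partial>lborel)
             (1 / enn2real q))"

text \<open>
  In the convexity clause, \<open>0 * \<infinity> = 0\<close> in \<^typ>\<open>ennreal\<close>, so excluding the weights 0 and 1 loses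
  nothing. Left-continuity is also required at \<open>\<infinity>\<close>; at 0 it is void, since \<open>at_left 0\<close> is trivial.
\<close>

definition young :: "(ennreal \<Rightarrow> ennreal) \<Rightarrow> bool" where
  "young A \<longleftrightarrow>
     (\<forall>x y. \<forall>u\<in>{0<..<1::real}.
        A (ennreal u * x + ennreal (1 - u) * y) \<le> ennreal u * A x + ennreal (1 - u) * A y) \<and>
     (\<forall>x. (A \<longlongrightarrow> A x) (at_left x)) \<and>
     A 0 = 0 \<and>
     \<not> (\<forall>x>0. A x = 0) \<and>
     \<not> (\<forall>x>0. A x = \<infinity>)"

definition luxemburg :: "(ennreal \<Rightarrow> ennreal) \<Rightarrow> fnorm" where
  "luxemburg A f = Inf (ennreal ` {l. 0 < l \<and>
     (\<integral>\<^sup>+x. A (ennreal (\<bar>f x\<bar> / l)) \<partial>unit_leb) \<le> 1})"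

definition embeds :: "fnorm \<Rightarrow> fnorm \<Rightarrow> bool" where
  "embeds X Y \<longleftrightarrow> (\<exists>C::real. C > 0 \<and> (\<forall>f\<in>fspace X. Y f \<le> ennreal C * X f))"

definition embeds_ac :: "fnorm \<Rightarrow> fnorm \<Rightarrow> bool" where
  "embeds_ac X Y \<longleftrightarrow>
     (\<forall>E :: nat \<Rightarrow> real set.
        (\<forall>n. E n \<in> sets unit_leb) \<longrightarrow>
        (AE x in unit_leb. (\<lambda>n. indicat_real (E n) x) \<longlonglongrightarrow> 0) \<longrightarrow>
        (\<lambda>n. SUP f \<in> {f \<in> borel_measurable unit_leb. X f \<le> 1}.
               Y (\<lambda>x. f x * indicat_real (E n) x)) \<longlonglongrightarrow> 0)"

definition sub_diagonal :: "fnorm \<Rightarrow> bool" where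
  "sub_diagonal X \<longleftrightarrow>
     fspace X = \<Union> {fspace (luxemburg A) | A. young A \<and> embeds (luxemburg A) X}"

definition uniformly_sub_diagonal :: "fnorm \<Rightarrow> bool" where
  "uniformly_sub_diagonal X \<longleftrightarrow>
     fspace X = \<Union> {fspace (luxemburg A) | A. young A \<and> embeds_ac (luxemburg A) X}"

end

theory Submission
  imports Defs "HOL-Real_Asymp.Real_Asymp"
begin

text \<open>
Throughout, $\theta = q/p$ and $m_k(f) = |\{|f| > 2^k\}|$. For finite $q$ the proof rests on the
dyadic bounds
\[ c \sum_k 2^{kq} m_k(f)^\theta \le \|f\|_{p,q}^q
   \le C \Bigl( |\{f \ne 0\}|^\theta + \sum_k 2^{kq} m_k(f)^\theta \Bigr) \]
(\<open>lorentz_int_lower\<close>, \<open>lorentz_int_upper\<close>), which replace computations with rearrangements by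
computations with series.

Let $q \le p$, so $\theta \le 1$, and let $f \in L^{p,q}$. Choose a decreasing positive sequence
$\nu_k \ge m_k(f)$ for which $w_k = 2^{kq} \nu_k^\theta$ is still summable, and an increasing
$\varphi_k \to \infty$ with $\sum_k w_k \varphi_k < \infty$. The numbers
$a_k = 2^{k(q-1)} \nu_k^{\theta-1} \varphi_k$ increase because $q \ge 1$ and $\theta \le 1$, so they
can serve as slopes of a Young function $A$, and $\int A(|g|)$ lies between constant multiples of
$\sum_k 2^k a_k m_{k+1}(g)$ and $\sum_k 2^k a_k m_k(g)$. Since
$2^k a_k m_k(f) \le 2^k a_k \nu_k = w_k \varphi_k$, the function $f$ lies in $L^A$.
Conversely, $m^\theta \le \nu^\theta + \nu^{\theta-1} m$ gives
$2^{kq} m^\theta \le \varphi_k^{-1} (w_k \varphi_k + 2^k a_k m)$ for every $m \ge 0$. Hence, uniformly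
over all $g$ with $\int A(|g|) \le 1$, the tail of the dyadic series of $g$ beyond index $N$ is
$O(1/\varphi_N)$ (\<open>exists_dyadic_young\<close>). This uniform smallness of tails is both the boundedness and
the almost-compactness of the embedding (\<open>exists_young_between\<close>).

Let $p < q$. The function $(t (1 - \ln t))^{-1/p}$ lies in $L^{p,q}$ but not in $L^p$ near 0. If it
lies in $L^A$, then $A(s) \le \varepsilon s^p$ for every $\varepsilon > 0$ and suitable arbitrarily
large $s$ (\<open>young_below_power\<close>). The functions $s \chi_{(0,m)}$ with $m = 1 / (\varepsilon s^p)$
then lie in the unit ball of $L^A$, have arbitrarily small support, and have $L^{p,q}$ norm at least
a constant times $\varepsilon^{-1/p}$. Such an $L^A$ therefore has no embedding into $L^{p,q}$,
bounded or almost compact (\<open>no_local_bound\<close>).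
\<close>

section \<open>The Lorentz functional and the distribution function\<close>

lemma epowr_ennreal: "0 \<le> x \<Longrightarrow> epowr (ennreal x) a = ennreal (x powr a)"
  by (simp add: epowr_def)

lemma epowr_top [simp]: "epowr top a = top"
  by (simp add: epowr_def)

lemma epowr_mono:
  assumes "x \<le> y" and "0 \<le> a"
  shows "epowr x a \<le> epowr y a"
proof (cases "y = top")
  case False
  then have "x \<noteq> top" using assms(1) top_unique by auto
  then show ?thesis using assms False
    by (auto simp: epowr_def top.not_eq_extremum intro!: ennreal_leI powr_mono2 enn2real_mono)
qed simp

lemma epowr_less_top_iff: "epowr x a < top \<longleftrightarrow> x < top"
  by (cases x) (auto simp: epowr_ennreal)

lemma nn_integral_powr_from_0:
  fixes e m :: real
  assumes "0 < e" and "0 \<le> m"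
  shows "(\<integral>\<^sup>+t. ennreal (t powr (e - 1)) * indicator {0<..<m} t \<partial>lborel) = ennreal (m powr e / e)"
proof -
  have "((\<lambda>x. x powr (e - 1)) has_integral (m powr e / e)) {0..m}"
    using has_integral_powr_from_0[of "e - 1" m] assms by simp
  then have "((\<lambda>x. x powr (e - 1)) has_integral (m powr e / e)) {0<..<m}"
    by (simp add: has_integral_Icc_iff_Ioo)
  then show ?thesis by (intro nn_integral_has_integral_lebesgue') auto
qed

text \<open>
The distribution function $|\{|f| > \lambda\}|$ as a real number, so that real powers of it make sense.
The decreasing rearrangement is its generalised inverse.
\<close>

definition level_measure :: "(real \<Rightarrow> real) \<Rightarrow> real \<Rightarrow> real" where
  "level_measure f l = measure unit_leb {x \<in> space unit_leb. \<bar>f x\<bar> > l}"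

lemma finite_unit_leb: "finite_measure unit_leb"
  by (rule finite_measure_lebesgue_on) auto

lemma emeasure_level: "emeasure unit_leb {x \<in> space unit_leb. \<bar>f x\<bar> > l} = ennreal (level_measure f l)"
  unfolding level_measure_def
  by (rule finite_measure.emeasure_eq_measure[OF finite_unit_leb])

lemma level_measure_nonneg [simp]: "0 \<le> level_measure f l"
  by (simp add: level_measure_def)

lemma emeasure_unit_leb_le_1: "emeasure unit_leb S \<le> 1"
proof -
  have "emeasure unit_leb S \<le> emeasure unit_leb (space unit_leb)"
    by (rule emeasure_space)
  also have "\<dots> = 1"
    by (simp add: emeasure_restrict_space)
  finally show ?thesis .
qed

lemma level_measure_le_1: "level_measure f l \<le> 1"
  using emeasure_unit_leb_le_1[of "{x \<in> space unit_leb. \<bar>f x\<bar> > l}"]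
  unfolding emeasure_level by simp

lemma level_set_sets:
  fixes f :: "real \<Rightarrow> real"
  assumes "f \<in> borel_measurable unit_leb"
  shows "{x \<in> space unit_leb. \<bar>f x\<bar> > l} \<in> sets unit_leb"
  using assms by measurable

lemma level_measure_antimono:
  assumes "f \<in> borel_measurable unit_leb" and "l \<le> l'"
  shows "level_measure f l' \<le> level_measure f l"
  unfolding level_measure_def
  by (rule finite_measure.finite_measure_mono[OF finite_unit_leb _ level_set_sets[OF assms(1)]])
     (use assms in auto)

lemma rearr_le:
  assumes "level_measure f l \<le> t" and "0 \<le> l"
  shows "rearr f t \<le> ennreal l"
  unfolding rearr_def emeasure_level using assms by (intro Inf_lower) (auto intro: ennreal_leI)

lemma level_measure_gt:
  assumes "ennreal l < rearr f t" and "0 \<le> l"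
  shows "t < level_measure f l"
  using rearr_le[of f l t] assms by (meson linorder_not_le)

lemma le_rearr:
  assumes f: "f \<in> borel_measurable unit_leb" and "t < level_measure f l" and "0 \<le> t"
  shows "ennreal l \<le> rearr f t"
  unfolding rearr_def emeasure_level
proof (rule Inf_greatest, clarify)
  fix s :: real
  assume "0 \<le> s" "ennreal (level_measure f s) \<le> ennreal t"
  then have "level_measure f s < level_measure f l" using assms by simp
  then have "l \<le> s" using level_measure_antimono[OF f, of s l] by force
  then show "ennreal l \<le> ennreal s" by (rule ennreal_leI)
qed

text \<open>
The $q$-th power of the Lorentz functional for finite $q = r$: the root is taken only at the end, so
that sums and limits can be handled inside the integral.
\<close>

definition lorentz_int :: "real \<Rightarrow> real \<Rightarrow> (real \<Rightarrow> real) \<Rightarrow> ennreal" where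
  "lorentz_int p r f = (\<integral>\<^sup>+t\<in>{0<..}. epowr (ennreal (t powr (1 / p)) * rearr f t) r / ennreal t \<partial>lborel)"

lemma lorentz_finite_index:
  assumes "0 < r"
  shows "lorentz p (ennreal r) f = epowr (lorentz_int p r f) (1 / r)"
  using assms by (simp add: lorentz_def lorentz_int_def)

lemma lorentz_integrand:
  assumes "0 < t" and "0 < r"
  shows "epowr (ennreal (t powr (1 / p)) * y) r / ennreal t = ennreal (t powr (r / p - 1)) * epowr y r"
proof (cases y)
  case (real z)
  have "(t powr (1 / p) * z) powr r / t = t powr (r / p - 1) * z powr r"
    using assms real by (simp add: powr_mult powr_powr powr_diff field_simps)
  then show ?thesis
    using assms real by (simp add: epowr_ennreal divide_ennreal flip: ennreal_mult)
next
  case top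
  then show ?thesis using assms
    by (simp add: ennreal_mult_top ennreal_top_divide epowr_def)
qed

lemma lorentz_int_alt:
  assumes "0 < r"
  shows "lorentz_int p r f
    = (\<integral>\<^sup>+t. ennreal (t powr (r / p - 1)) * epowr (rearr f t) r * indicator {0<..} t \<partial>lborel)"
  unfolding lorentz_int_def
  by (rule nn_integral_cong) (auto simp: lorentz_integrand[OF _ assms] split: split_indicator)

lemma nn_integral_powr_level:
  assumes "0 < p" "0 < r" "0 \<le> m" "0 \<le> c"
  shows "(\<integral>\<^sup>+t. ennreal (t powr (r / p - 1)) * (ennreal c * indicator {0<..<m} t) \<partial>lborel)
    = ennreal (p / r) * ennreal (c * m powr (r / p))"
proof -
  have "(\<integral>\<^sup>+t. ennreal (t powr (r / p - 1)) * (ennreal c * indicator {0<..<m} t) \<partial>lborel)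
      = (\<integral>\<^sup>+t. ennreal c * (ennreal (t powr (r / p - 1)) * indicator {0<..<m} t) \<partial>lborel)"
    by (simp add: ac_simps)
  also have "\<dots> = ennreal c * ennreal (m powr (r / p) / (r / p))"
    using assms by (subst nn_integral_cmult) (auto simp: nn_integral_powr_from_0)
  also have "\<dots> = ennreal (p / r) * ennreal (c * m powr (r / p))"
    using assms by (simp flip: ennreal_mult add: field_simps)
  finally show ?thesis .
qed

section \<open>Dyadic form of the Lorentz functional\<close>

text \<open>
For conditions $P$ that hold on an initial segment, such as $2^k < x$. The segment may be empty or
infinite, so no last index is singled out.
\<close>

lemma downward_closed_sum_le:
  fixes v :: "nat \<Rightarrow> ennreal"
  assumes down: "\<And>k. P (Suc k) \<Longrightarrow> P k"
    and partial: "\<And>n. P n \<Longrightarrow> (\<Sum>k\<le>n. v k) \<le> V"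
  shows "(\<Sum>k. if P k then v k else 0) \<le> V"
proof (rule suminf_le_const[OF summableI])
  fix n
  show "(\<Sum>k<n. if P k then v k else 0) \<le> V"
  proof (induction n)
    case (Suc n)
    show ?case
    proof (cases "P n")
      case True
      have "P k" if "k \<le> n" for k
        using that by (induction rule: inc_induct) (use True down in auto)
      then have "(\<Sum>k<Suc n. if P k then v k else 0) = (\<Sum>k\<le>n. v k)"
        by (intro sum.cong) auto
      then show ?thesis using partial[OF True] by simp
    qed (use Suc in simp)
  qed simp
qed

lemma dyadic_bracket:
  fixes z :: real
  assumes "1 < z"
  obtains n :: nat where "2 ^ n < z" and "z \<le> 2 ^ Suc n"
proof -
  obtain N :: nat where "z \<le> 2 ^ N"
    using real_arch_pow[of 2 z] by (auto intro: less_imp_le)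
  then have "\<exists>n. 2 ^ n < z \<and> z \<le> 2 ^ Suc n"
  proof (induction N)
    case (Suc N)
    then show ?case by (cases "z \<le> 2 ^ N") (auto intro: exI[of _ N])
  qed (use assms in simp)
  then show ?thesis using that by blast
qed

text \<open>
If $2^n < y \le 2^{n+1}$, the single term $k = n$ suffices. For $y \le 1$ no term is present, which
is why the summand for $y > 0$ is needed; for $y = \infty$ the series diverges.
\<close>

lemma epowr_le_dyadic_sum:
  assumes r: "0 < r"
  shows "epowr y r \<le> (if 0 < y then 1 else 0)
    + (\<Sum>k. if ennreal (2 ^ k) < y then ennreal (2 powr (r * real (Suc k))) else 0)"
    (is "_ \<le> _ + suminf ?u")
proof (cases y)
  case top
  have "of_nat n \<le> suminf ?u" for n
  proof -
    have "of_nat n = (\<Sum>k<n. 1 :: ennreal)" by simp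
    also have "\<dots> \<le> (\<Sum>k<n. ?u k)"
    proof (rule sum_mono)
      fix k
      have "1 \<le> 2 powr (r * real (Suc k))"
        using r by (intro ge_one_powr_ge_zero) auto
      then show "1 \<le> ?u k" using top by (simp del: of_nat_Suc)
    qed
    also have "\<dots> \<le> suminf ?u"
      by (rule sum_le_suminf[OF summableI]) auto
    finally show ?thesis .
  qed
  then have "(SUP n. of_nat n) \<le> suminf ?u"
    by (intro SUP_least)
  then have "suminf ?u = top"
    unfolding ennreal_SUP_of_nat_eq_top by (simp add: top_unique)
  then show ?thesis by simp
next
  case (real z)
  consider "z = 0" | "0 < z" "z \<le> 1" | "1 < z" using real by linarith
  then show ?thesis
  proof cases
    case 2
    then have "z powr r \<le> 1" using r by (simp add: powr_le1)
    then have "epowr y r \<le> 1" using real by (simp add: epowr_ennreal)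
    then show ?thesis using real 2 by (simp add: add_increasing2)
  next
    case 3
    obtain n where n: "2 ^ n < z" "z \<le> 2 ^ Suc n"
      using dyadic_bracket[OF 3] .
    have "z powr r \<le> (2 powr real (Suc n)) powr r"
      using n r real by (intro powr_mono2) (auto simp: powr_realpow simp del: of_nat_Suc)
    then have "epowr y r \<le> ?u n"
      using real n by (simp add: epowr_ennreal powr_powr mult.commute ennreal_leI ennreal_less_iff del: of_nat_Suc)
    also have "\<dots> \<le> suminf ?u"
      using sum_le_suminf[OF summableI, of "{n}" ?u] by simp
    finally show ?thesis by (simp add: add_increasing)
  qed (use real r in \<open>simp add: epowr_def\<close>)
qed

lemma dyadic_geometric_sum:
  fixes r :: real
  assumes "1 \<le> r"
  shows "(\<Sum>k\<le>n. 2 powr (r * real k)) \<le> 2 * 2 powr (r * real n)"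
proof (induction n)
  case (Suc n)
  have "2 * 2 powr (r * real n) \<le> 2 powr r * 2 powr (r * real n)"
    using powr_mono[of 1 r 2] assms by (intro mult_right_mono) auto
  also have "\<dots> = 2 powr (r * real (Suc n))"
    by (simp add: powr_add[symmetric] algebra_simps)
  finally show ?case using Suc by simp
qed simp

text \<open>
Inserting the pointwise bound by dyadic indicators and using $f^*(t) > 2^k \Longrightarrow t < m_k(f)$
leaves the elementary integrals $\int_0^{m_k} t^{r/p-1}\,dt$.
\<close>

lemma lorentz_int_upper:
  assumes p: "0 < p" and r: "0 < r"
  shows "lorentz_int p r f \<le> ennreal (p / r) * (ennreal (level_measure f 0 powr (r / p))
    + (\<Sum>k. ennreal (2 powr (r * real (Suc k)) * level_measure f (2 ^ k) powr (r / p))))"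
proof -
  let ?I = "\<lambda>l t. indicator {0<..<level_measure f l} t :: ennreal"
  let ?c = "\<lambda>k. ennreal (2 powr (r * real (Suc k)))"
  have level: "(if ennreal l < rearr f t then c else 0) \<le> c * ?I l t" if "0 < t" "0 \<le> l" for c l t
    using level_measure_gt[of l f t] that by auto
  have "lorentz_int p r f \<le>
    (\<integral>\<^sup>+t. ennreal (t powr (r / p - 1)) * (ennreal 1 * ?I 0 t + (\<Sum>k. ?c k * ?I (2 ^ k) t)) \<partial>lborel)"
    unfolding lorentz_int_alt[OF r]
  proof (rule nn_integral_mono)
    fix t :: real
    have "epowr (rearr f t) r \<le> ennreal 1 * ?I 0 t + (\<Sum>k. ?c k * ?I (2 ^ k) t)" if "0 < t"
    proof -
      note epowr_le_dyadic_sum[OF r]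
      also have "(if 0 < rearr f t then 1 else 0)
        + (\<Sum>k. if ennreal (2 ^ k) < rearr f t then ?c k else 0)
          \<le> ennreal 1 * ?I 0 t + (\<Sum>k. ?c k * ?I (2 ^ k) t)"
        using level[OF that, of 0 1] by (intro add_mono suminf_le summableI level that) auto
      finally show ?thesis .
    qed
    then show "ennreal (t powr (r / p - 1)) * epowr (rearr f t) r * indicator {0<..} t
      \<le> ennreal (t powr (r / p - 1)) * (ennreal 1 * ?I 0 t + (\<Sum>k. ?c k * ?I (2 ^ k) t))"
      by (auto intro: mult_left_mono split: split_indicator)
  qed
  also have "\<dots> = (\<integral>\<^sup>+t. ennreal (t powr (r / p - 1)) * (ennreal 1 * ?I 0 t) \<partial>lborel)
    + (\<integral>\<^sup>+t. (\<Sum>k. ennreal (t powr (r / p - 1)) * (?c k * ?I (2 ^ k) t)) \<partial>lborel)"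
    unfolding distrib_left ennreal_suminf_cmult[symmetric]
    by (rule nn_integral_add) measurable
  also have "\<dots> = (\<integral>\<^sup>+t. ennreal (t powr (r / p - 1)) * (ennreal 1 * ?I 0 t) \<partial>lborel)
    + (\<Sum>k. \<integral>\<^sup>+t. ennreal (t powr (r / p - 1)) * (?c k * ?I (2 ^ k) t) \<partial>lborel)"
    by (subst nn_integral_suminf) measurable
  also have "\<dots> = ennreal (p / r) * ennreal (1 * level_measure f 0 powr (r / p))
    + (\<Sum>k. ennreal (p / r) * ennreal (2 powr (r * real (Suc k)) * level_measure f (2 ^ k) powr (r / p)))"
    unfolding nn_integral_powr_level[OF p r level_measure_nonneg zero_le_one]
      nn_integral_powr_level[OF p r level_measure_nonneg powr_ge_zero] ..
  finally show ?thesis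
    by (simp add: distrib_left)
qed

lemma rearr_antimono:
  assumes "s \<le> t"
  shows "rearr f t \<le> rearr f s"
  unfolding rearr_def
  by (intro Inf_superset_mono image_mono Collect_mono) (use assms in \<open>auto intro: order_trans ennreal_leI\<close>)

lemma epowr_rearr_borel:
  assumes "0 \<le> r"
  shows "(\<lambda>t. epowr (rearr f t) r) \<in> borel_measurable borel"
proof (rule borel_measurableI_greater)
  fix y
  have "is_interval {t. y < epowr (rearr f t) r}"
    unfolding is_interval_1
    using epowr_mono[OF rearr_antimono assms, of _ _ f] by (blast intro: less_le_trans)
  then show "{t \<in> space borel. y < epowr (rearr f t) r} \<in> sets borel"
    by (simp add: real_interval_borel_measurable)
qed

text \<open>
At a point $t$ the terms with $t < m_k(f)$ satisfy $2^k \le f^*(t)$ and form a geometric sum that is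
at most twice its last term, hence at most $2 f^*(t)^r$.
\<close>

lemma lorentz_int_lower:
  assumes p: "0 < p" and r: "1 \<le> r" and f: "f \<in> borel_measurable unit_leb"
  shows "ennreal (p / r) * (\<Sum>k. ennreal (2 powr (r * real k) * level_measure f (2 ^ k) powr (r / p)))
    \<le> 2 * lorentz_int p r f"
proof -
  have r0: "0 < r" using r by simp
  let ?I = "\<lambda>l t. indicator {0<..<level_measure f l} t :: ennreal"
  let ?c = "\<lambda>k. ennreal (2 powr (r * real k))"
  have pointwise: "(\<Sum>k. ?c k * ?I (2 ^ k) t) \<le> 2 * epowr (rearr f t) r" if t: "0 < t" for t
  proof -
    have "(\<Sum>k. if t < level_measure f (2 ^ k) then ?c k else 0) \<le> 2 * epowr (rearr f t) r"
    proof (rule downward_closed_sum_le)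
      fix k
      assume "t < level_measure f (2 ^ Suc k)"
      then show "t < level_measure f (2 ^ k)"
        using level_measure_antimono[OF f, of "2 ^ k" "2 ^ Suc k"] by simp
    next
      fix n
      assume "t < level_measure f (2 ^ n)"
      then have le: "ennreal (2 ^ n) \<le> rearr f t"
        using le_rearr[OF f] t by simp
      have "(\<Sum>k\<le>n. ?c k) \<le> ennreal (2 * 2 powr (r * real n))"
        by (simp add: dyadic_geometric_sum[OF r] ennreal_leI)
      also have "\<dots> = 2 * epowr (ennreal (2 ^ n)) r"
        by (simp add: epowr_ennreal ennreal_mult' powr_powr mult.commute flip: powr_realpow)
      also have "\<dots> \<le> 2 * epowr (rearr f t) r"
        using le r by (intro mult_left_mono epowr_mono) auto
      finally show "(\<Sum>k\<le>n. ?c k) \<le> 2 * epowr (rearr f t) r" .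
    qed
    also have "(\<Sum>k. if t < level_measure f (2 ^ k) then ?c k else 0) = (\<Sum>k. ?c k * ?I (2 ^ k) t)"
      using t by (intro suminf_cong) (auto split: split_indicator)
    finally show ?thesis .
  qed
  have "ennreal (p / r) * (\<Sum>k. ennreal (2 powr (r * real k) * level_measure f (2 ^ k) powr (r / p)))
    = (\<Sum>k. \<integral>\<^sup>+t. ennreal (t powr (r / p - 1)) * (?c k * ?I (2 ^ k) t) \<partial>lborel)"
    unfolding nn_integral_powr_level[OF p r0 level_measure_nonneg powr_ge_zero]
    by simp
  also have "\<dots> = (\<integral>\<^sup>+t. (\<Sum>k. ennreal (t powr (r / p - 1)) * (?c k * ?I (2 ^ k) t)) \<partial>lborel)"
    by (subst nn_integral_suminf) measurable
  also have "\<dots> \<le> (\<integral>\<^sup>+t. 2 * (ennreal (t powr (r / p - 1)) * epowr (rearr f t) r * indicator {0<..} t) \<partial>lborel)"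
  proof (rule nn_integral_mono)
    fix t :: real
    show "(\<Sum>k. ennreal (t powr (r / p - 1)) * (?c k * ?I (2 ^ k) t))
      \<le> 2 * (ennreal (t powr (r / p - 1)) * epowr (rearr f t) r * indicator {0<..} t)"
    proof (cases "0 < t")
      case True
      have "(\<Sum>k. ennreal (t powr (r / p - 1)) * (?c k * ?I (2 ^ k) t))
        \<le> ennreal (t powr (r / p - 1)) * (2 * epowr (rearr f t) r)"
        using pointwise[OF True] by (simp add: mult_left_mono)
      then show ?thesis using True by (simp add: ac_simps)
    qed simp
  qed
  also have "\<dots> = 2 * lorentz_int p r f"
    unfolding lorentz_int_alt[OF r0]
    using epowr_rearr_borel[of r f] r0 by (subst nn_integral_cmult) auto
  finally show ?thesis .
qed

text \<open>
Functions of small support with uniformly small dyadic tails have small norm: the levels up to $N$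
contribute at most a constant times $e^{r/p}$, where $e$ bounds the measure of the support. The tail is
shifted by one index because a Young function controls level $2^{k+1}$ by its slope at $2^k$.
\<close>

lemma lorentz_int_tail_bound:
  assumes p: "0 < p" and r: "0 < r" and f: "f \<in> borel_measurable unit_leb"
    and e: "level_measure f 0 \<le> e" and T: "0 \<le> T"
    and tail: "(\<Sum>k. ennreal (2 powr (r * real (N + k)) * level_measure f (2 ^ Suc (N + k)) powr (r / p)))
      \<le> ennreal T"
  shows "lorentz_int p r f
    \<le> ennreal (p / r * ((1 + (\<Sum>k\<le>N. 2 powr (r * real (Suc k)))) * e powr (r / p) + 4 powr r * T))"
proof -
  let ?u = "\<lambda>k. ennreal (2 powr (r * real (Suc k)) * level_measure f (2 ^ k) powr (r / p))"
  let ?S = "\<Sum>k\<le>N. 2 powr (r * real (Suc k))"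
  have e0: "0 \<le> e" using e level_measure_nonneg[of f 0] by linarith
  have below: "level_measure f l powr (r / p) \<le> e powr (r / p)" if "0 \<le> l" for l
    using level_measure_antimono[OF f that] e p r by (intro powr_mono2) auto
  have shift: "?u (k + Suc N)
    = ennreal (4 powr r) * ennreal (2 powr (r * real (N + k)) * level_measure f (2 ^ Suc (N + k)) powr (r / p))"
    for k
  proof -
    have "(4::real) powr r = 2 powr (r * 2)"
      using powr_powr[of "2::real" 2 r] by (simp add: mult.commute)
    moreover have "2 powr (r * real (Suc (k + Suc N))) = 2 powr (r * 2) * 2 powr (r * real (N + k))"
      by (simp add: powr_add[symmetric] algebra_simps)
    ultimately show ?thesis
      by (simp add: ennreal_mult'[symmetric] mult.assoc add.commute)
  qed
  have "(\<Sum>k. ?u (k + Suc N)) \<le> ennreal (4 powr r) * ennreal T"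
    unfolding shift ennreal_suminf_cmult by (rule mult_left_mono[OF tail]) simp
  moreover have "(\<Sum>k<Suc N. ?u k) \<le> ennreal (?S * e powr (r / p))"
  proof -
    have "(\<Sum>k<Suc N. ?u k) = ennreal (\<Sum>k\<le>N. 2 powr (r * real (Suc k)) * level_measure f (2 ^ k) powr (r / p))"
      by (simp add: lessThan_Suc_atMost del: sum.lessThan_Suc)
    also have "\<dots> \<le> ennreal (?S * e powr (r / p))"
      unfolding sum_distrib_right by (intro ennreal_leI sum_mono mult_left_mono below) auto
    finally show ?thesis .
  qed
  moreover have "suminf ?u = (\<Sum>k. ?u (k + Suc N)) + (\<Sum>k<Suc N. ?u k)"
    by (rule suminf_offset[OF summableI])
  ultimately have "suminf ?u \<le> ennreal (4 powr r) * ennreal T + ennreal (?S * e powr (r / p))"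
    by (simp only: add_mono)
  then have "ennreal (level_measure f 0 powr (r / p)) + suminf ?u
    \<le> ennreal (e powr (r / p)) + (ennreal (4 powr r) * ennreal T + ennreal (?S * e powr (r / p)))"
    using below[of 0] by (intro add_mono ennreal_leI) auto
  also have "\<dots> = ennreal ((1 + ?S) * e powr (r / p) + 4 powr r * T)"
    using T by (simp add: ennreal_mult'[symmetric] ennreal_plus[symmetric] sum_nonneg algebra_simps
        del: ennreal_plus)
  finally have "ennreal (level_measure f 0 powr (r / p)) + suminf ?u
    \<le> ennreal ((1 + ?S) * e powr (r / p) + 4 powr r * T)" .
  then have "ennreal (p / r) * (ennreal (level_measure f 0 powr (r / p)) + suminf ?u)
    \<le> ennreal (p / r * ((1 + ?S) * e powr (r / p) + 4 powr r * T))"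
    using p r by (subst ennreal_mult') (auto intro: mult_left_mono)
  then show ?thesis
    using lorentz_int_upper[OF p r, of f] by (rule order_trans[rotated])
qed

lemma epowr_cmult:
  assumes "0 < c"
  shows "epowr (ennreal c * x) a = ennreal (c powr a) * epowr x a"
  using assms
  by (cases x) (auto simp: epowr_ennreal ennreal_mult'[symmetric] powr_mult ennreal_mult_top)

lemma le_ennreal_mult_InfI:
  assumes C: "0 < C" and le: "\<And>x. x \<in> X \<Longrightarrow> y \<le> ennreal C * x"
  shows "y \<le> ennreal C * Inf X"
proof -
  have "y / ennreal C \<le> Inf X"
    using C le by (intro Inf_greatest divide_le_posI_ennreal) auto
  then have "ennreal C * (y / ennreal C) \<le> ennreal C * Inf X"
    by (rule mult_left_mono) simp
  moreover have "ennreal C * (y / ennreal C) = y"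
    unfolding ennreal_times_divide mult.commute[of "ennreal C"]
    using C by (intro mult_divide_eq_ennreal) auto
  ultimately show ?thesis by simp
qed

lemma rearr_scale_le:
  assumes l: "0 < l"
  shows "rearr f t \<le> ennreal l * rearr (\<lambda>x. f x / l) t"
  unfolding rearr_def[of "\<lambda>x. f x / l"]
proof (rule le_ennreal_mult_InfI[OF l], clarify)
  fix s :: real
  assume s: "0 \<le> s" "emeasure unit_leb {x \<in> space unit_leb. s < \<bar>f x / l\<bar>} \<le> ennreal t"
  have "{x \<in> space unit_leb. s < \<bar>f x / l\<bar>} = {x \<in> space unit_leb. l * s < \<bar>f x\<bar>}"
    using l by (auto simp: field_simps)
  then have "rearr f t \<le> ennreal (l * s)"
    unfolding rearr_def using s l by (intro Inf_lower imageI) auto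
  then show "rearr f t \<le> ennreal l * ennreal s"
    using l by (simp add: ennreal_mult')
qed

lemma lorentz_scale_le:
  assumes l: "0 < l" and r: "0 < r"
  shows "lorentz p (ennreal r) f \<le> ennreal l * lorentz p (ennreal r) (\<lambda>x. f x / l)"
proof -
  let ?g = "\<lambda>x. f x / l"
  have "lorentz_int p r f \<le>
    (\<integral>\<^sup>+t. ennreal (l powr r) * (ennreal (t powr (r / p - 1)) * epowr (rearr ?g t) r * indicator {0<..} t) \<partial>lborel)"
    unfolding lorentz_int_alt[OF r]
  proof (rule nn_integral_mono)
    fix t
    have "epowr (rearr f t) r \<le> ennreal (l powr r) * epowr (rearr ?g t) r"
      using epowr_mono[OF rearr_scale_le[OF l, of f t], of r] r by (simp add: epowr_cmult[OF l])
    then have "ennreal (t powr (r / p - 1)) * epowr (rearr f t) r * indicator {0<..} t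
      \<le> ennreal (t powr (r / p - 1)) * (ennreal (l powr r) * epowr (rearr ?g t) r) * indicator {0<..} t"
      by (intro mult_right_mono mult_left_mono) auto
    then show "ennreal (t powr (r / p - 1)) * epowr (rearr f t) r * indicator {0<..} t
      \<le> ennreal (l powr r) * (ennreal (t powr (r / p - 1)) * epowr (rearr ?g t) r * indicator {0<..} t)"
      by (simp only: ac_simps)
  qed
  also have "\<dots> = ennreal (l powr r) * lorentz_int p r ?g"
    unfolding lorentz_int_alt[OF r] using epowr_rearr_borel[of r ?g] r
    by (intro nn_integral_cmult) auto
  finally have "epowr (lorentz_int p r f) (1 / r)
    \<le> epowr (ennreal (l powr r) * lorentz_int p r ?g) (1 / r)"
    using r by (intro epowr_mono) auto
  also have "\<dots> = ennreal l * epowr (lorentz_int p r ?g) (1 / r)"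
    using l r by (simp add: epowr_cmult powr_powr)
  finally show ?thesis by (simp add: lorentz_finite_index[OF r])
qed

lemma fspace_lorentz_iff:
  assumes "0 < r"
  shows "f \<in> fspace (lorentz p (ennreal r)) \<longleftrightarrow> f \<in> borel_measurable unit_leb \<and> lorentz_int p r f < top"
  using assms by (simp add: fspace_def lorentz_finite_index epowr_less_top_iff)

text \<open>
Bounded functions belong to the Lorentz space, so only the large values of $f$ decide about
membership. In dyadic form this is the remark that truncation at height $n$ changes none of the
measures $m_k$ with $2^k \ge n$.
\<close>

lemma lorentz_int_finite_if_large_part:
  assumes p: "0 < p" and r: "1 \<le> r" and f: "f \<in> borel_measurable unit_leb"
    and g: "(\<lambda>x. f x * indicat_real E x) \<in> borel_measurable unit_leb"
    and E: "E = {x \<in> space unit_leb. real n < \<bar>f x\<bar>}"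
    and fin: "lorentz_int p r (\<lambda>x. f x * indicat_real E x) < top"
  shows "lorentz_int p r f < top"
proof -
  let ?g = "\<lambda>x. f x * indicat_real E x"
  have r0: "0 < r" using r by simp
  have level: "level_measure f l = level_measure ?g l" if "real n \<le> l" for l
  proof -
    have "{x \<in> space unit_leb. l < \<bar>f x\<bar>} = {x \<in> space unit_leb. l < \<bar>?g x\<bar>}"
      using that by (auto simp: E indicator_def)
    then show ?thesis by (simp add: level_measure_def)
  qed
  let ?w = "\<lambda>k. ennreal (2 powr (r * real k) * level_measure ?g (2 ^ k) powr (r / p))"
  have "ennreal (p / r) * suminf ?w < top"
    using fin by (intro le_less_trans[OF lorentz_int_lower[OF p r g]]) (simp add: ennreal_mult_less_top)
  then have "suminf ?w < top"
    using p r0 by (auto simp: ennreal_mult_less_top)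
  then obtain T where T: "0 \<le> T" "suminf ?w = ennreal T"
    unfolding less_top_ennreal by blast
  have "(\<Sum>k. ennreal (2 powr (r * real (n + k)) * level_measure f (2 ^ Suc (n + k)) powr (r / p)))
    \<le> (\<Sum>k. ?w (k + Suc n))"
  proof (intro suminf_le summableI ennreal_leI)
    fix k
    have "real n \<le> 2 ^ n" by (rule less_imp_le[OF of_nat_less_two_power])
    also have "\<dots> \<le> 2 ^ Suc (n + k)" by (rule power_increasing) auto
    finally have "real n \<le> 2 ^ Suc (n + k)" .
    then show "2 powr (r * real (n + k)) * level_measure f (2 ^ Suc (n + k)) powr (r / p)
      \<le> 2 powr (r * real (k + Suc n)) * level_measure ?g (2 ^ (k + Suc n)) powr (r / p)"
      using r by (simp add: level add.commute mult_right_mono)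
  qed
  also have "\<dots> \<le> suminf ?w"
    unfolding suminf_offset[OF summableI, of ?w "Suc n"] by (rule add_increasing2) auto
  finally have tail: "(\<Sum>k. ennreal (2 powr (r * real (n + k)) * level_measure f (2 ^ Suc (n + k)) powr (r / p)))
    \<le> ennreal T"
    using T by simp
  show ?thesis
    using lorentz_int_tail_bound[OF p r0 f level_measure_le_1 T(1) tail] by (rule le_less_trans) simp
qed

section \<open>Young functions with prescribed dyadic slopes\<close>

text \<open>
A supremum of the convex functions $x \mapsto a_k (x - 2^k)_+$. For increasing $a$ its value at
$2^{k+1}$ is $a_k 2^k$ up to a factor 2, as for a primitive of the step function with value $a_k$ between
$2^k$ and $2^{k+1}$. Convexity and left-continuity on all of $[0,\infty]$ are inherited from the
truncated differences.
\<close>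

definition dyadic_young :: "(nat \<Rightarrow> real) \<Rightarrow> ennreal \<Rightarrow> ennreal" where
  "dyadic_young a x = (SUP k. ennreal (a k) * (x - ennreal (2 ^ k)))"

lemma dyadic_young_ge: "ennreal (a k) * (x - ennreal (2 ^ k)) \<le> dyadic_young a x"
  unfolding dyadic_young_def by (rule SUP_upper) simp

lemma dyadic_young_mono: "x \<le> y \<Longrightarrow> dyadic_young a x \<le> dyadic_young a y"
  unfolding dyadic_young_def by (intro SUP_mono' mult_left_mono ennreal_minus_mono) auto

lemma positive_part_convex:
  assumes u: "0 < u" "u < 1" and c: "0 \<le> c"
  shows "(ennreal u * x + ennreal (1 - u) * y) - ennreal c
    \<le> ennreal u * (x - ennreal c) + ennreal (1 - u) * (y - ennreal c)"
proof -
  have split: "z \<le> ennreal c + (z - ennreal c)" for z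
    using ennreal_minus_le_iff[of z "ennreal c" "z - ennreal c"] by simp
  have "ennreal u * x + ennreal (1 - u) * y
    \<le> ennreal u * (ennreal c + (x - ennreal c)) + ennreal (1 - u) * (ennreal c + (y - ennreal c))"
    by (intro add_mono mult_left_mono split) auto
  also have "\<dots> = (ennreal u + ennreal (1 - u)) * ennreal c
    + (ennreal u * (x - ennreal c) + ennreal (1 - u) * (y - ennreal c))"
    by (simp add: algebra_simps)
  also have "ennreal u + ennreal (1 - u) = 1"
    using u by (simp flip: ennreal_plus)
  finally show ?thesis
    by (simp add: ennreal_minus_le_iff)
qed

lemma young_dyadic_young:
  assumes a: "\<And>k. 0 < a k"
  shows "young (dyadic_young a)"
  unfolding young_def
proof (intro conjI allI ballI)
  fix x y :: ennreal and u :: real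
  assume "u \<in> {0<..<1}"
  then have u: "0 < u" "u < 1" by auto
  show "dyadic_young a (ennreal u * x + ennreal (1 - u) * y)
    \<le> ennreal u * dyadic_young a x + ennreal (1 - u) * dyadic_young a y"
    unfolding dyadic_young_def[of a "ennreal u * x + ennreal (1 - u) * y"]
  proof (rule SUP_least)
    fix k
    have "ennreal (a k) * (ennreal u * x + ennreal (1 - u) * y - ennreal (2 ^ k))
      \<le> ennreal (a k) * (ennreal u * (x - ennreal (2 ^ k)) + ennreal (1 - u) * (y - ennreal (2 ^ k)))"
      by (intro mult_left_mono positive_part_convex u) auto
    also have "\<dots> = ennreal u * (ennreal (a k) * (x - ennreal (2 ^ k)))
        + ennreal (1 - u) * (ennreal (a k) * (y - ennreal (2 ^ k)))"
      by (simp add: algebra_simps)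
    also have "\<dots> \<le> ennreal u * dyadic_young a x + ennreal (1 - u) * dyadic_young a y"
      by (intro add_mono mult_left_mono dyadic_young_ge) auto
    finally show "ennreal (a k) * (ennreal u * x + ennreal (1 - u) * y - ennreal (2 ^ k)) \<le> \<dots>" .
  qed
next
  fix x
  \<comment> \<open>A supremum of increasing continuous functions is left-continuous.\<close>
  show "(dyadic_young a \<longlongrightarrow> dyadic_young a x) (at_left x)"
  proof (rule order_tendstoI)
    fix c
    assume "c < dyadic_young a x"
    then obtain k where k: "c < ennreal (a k) * (x - ennreal (2 ^ k))"
      unfolding dyadic_young_def by (auto simp: less_SUP_iff)
    have "((\<lambda>y. ennreal (a k) * (y - ennreal (2 ^ k))) \<longlongrightarrow> ennreal (a k) * (x - ennreal (2 ^ k))) (at_left x)"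
      by (intro ennreal_tendsto_cmult tendsto_diff_ennreal_general tendsto_ident_at tendsto_const) auto
    then have "eventually (\<lambda>y. c < ennreal (a k) * (y - ennreal (2 ^ k))) (at_left x)"
      using k by (rule order_tendstoD)
    then show "eventually (\<lambda>y. c < dyadic_young a y) (at_left x)"
      by eventually_elim (use dyadic_young_ge less_le_trans in blast)
  next
    fix c
    assume "dyadic_young a x < c"
    then show "eventually (\<lambda>y. dyadic_young a y < c) (at_left x)"
      using dyadic_young_mono[OF less_imp_le, of _ x a]
      by (auto simp: eventually_at_filter intro!: always_eventually intro: le_less_trans)
  qed
next
  show "dyadic_young a 0 = 0"
    by (simp add: dyadic_young_def)
next
  have "ennreal (a 0) * (top - ennreal (2 ^ 0)) = top"
    using a[of 0] by (simp add: ennreal_mult_top)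
  then have "dyadic_young a top \<noteq> 0"
    using dyadic_young_ge[of a 0 top] by (auto simp: top_unique)
  then show "\<not> (\<forall>x>0. dyadic_young a x = 0)"
    by (metis ennreal_zero_less_top)
next
  have "ennreal 1 - ennreal (2 ^ k) = 0" for k
    by (subst ennreal_minus) (auto simp: ennreal_neg)
  then have "dyadic_young a 1 = 0"
    by (simp add: dyadic_young_def)
  then show "\<not> (\<forall>x>0. dyadic_young a x = \<infinity>)"
    by (auto intro!: exI[of _ 1])
qed

lemma dyadic_young_scale:
  assumes l: "1 \<le> l" and z: "0 \<le> z"
  shows "dyadic_young a (ennreal (z / l)) \<le> ennreal (1 / l) * dyadic_young a (ennreal z)"
  unfolding dyadic_young_def[of a "ennreal (z / l)"]
proof (rule SUP_least)
  fix k
  have "z / l - 2 ^ k \<le> 1 / l * (z - 2 ^ k)"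
    using l by (simp add: field_simps)
  then have "ennreal (z / l) - ennreal (2 ^ k) \<le> ennreal (1 / l) * (ennreal z - ennreal (2 ^ k))"
    using l z by (simp add: ennreal_minus ennreal_mult'[symmetric] ennreal_leI)
  then have "ennreal (a k) * (ennreal (z / l) - ennreal (2 ^ k))
    \<le> ennreal (a k) * (ennreal (1 / l) * (ennreal z - ennreal (2 ^ k)))"
    by (rule mult_left_mono) simp
  also have "\<dots> = ennreal (1 / l) * (ennreal (a k) * (ennreal z - ennreal (2 ^ k)))"
    by (simp only: ac_simps)
  also have "\<dots> \<le> ennreal (1 / l) * dyadic_young a (ennreal z)"
    by (intro mult_left_mono dyadic_young_ge) simp
  finally show "ennreal (a k) * (ennreal (z / l) - ennreal (2 ^ k)) \<le> \<dots>" .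
qed


text \<open>
If $2^n < z \le 2^{n+1}$, monotonicity of $a$ bounds every $a_k (z - 2^k)_+$ by $a_n 2^{n+1}$, which is
the term $k = n$.
\<close>

lemma dyadic_young_upper:
  assumes a: "\<And>k. 0 < a k" and mono: "\<And>i j. i \<le> j \<Longrightarrow> a i \<le> a j" and z: "0 \<le> z"
  shows "dyadic_young a (ennreal z) \<le> (\<Sum>k. if 2 ^ k < z then ennreal (2 * (a k * 2 ^ k)) else 0)"
    (is "_ \<le> suminf ?u")
  unfolding dyadic_young_def
proof (rule SUP_least)
  fix k
  show "ennreal (a k) * (ennreal z - ennreal (2 ^ k)) \<le> suminf ?u"
  proof (cases "z \<le> 2 ^ k")
    case True
    then show ?thesis by (simp add: ennreal_minus ennreal_neg)
  next
    case False
    moreover have "(1::real) \<le> 2 ^ k" by simp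
    ultimately have "1 < z" by linarith
    then obtain n where n: "2 ^ n < z" "z \<le> 2 ^ Suc n"
      by (rule dyadic_bracket)
    have "(2::real) ^ k < 2 ^ Suc n" using False n by linarith
    then have "k \<le> n" by (simp add: power_strict_increasing_iff less_Suc_eq_le del: power_Suc)
    have "0 \<le> z - 2 ^ k" "z - 2 ^ k \<le> 2 ^ Suc n"
      using n False zero_less_power[of "2::real" k] by linarith+
    then have "a k * (z - 2 ^ k) \<le> a n * 2 ^ Suc n"
      using mono[OF \<open>k \<le> n\<close>] a[of n] by (intro mult_mono) auto
    then have "ennreal (a k) * (ennreal z - ennreal (2 ^ k)) \<le> ?u n"
      using n a[of k] False by (simp add: ennreal_minus ennreal_mult'[symmetric] ennreal_leI mult.left_commute)
    also have "\<dots> \<le> suminf ?u"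
      using sum_le_suminf[OF summableI, of "{n}" ?u] by simp
    finally show ?thesis .
  qed
qed

text \<open>
For $z > 2^{n+1}$ the terms up to $n$ add up to at most $a_n 2^n \le a_n (z - 2^n)$.
\<close>

lemma dyadic_young_lower:
  assumes a: "\<And>k. 0 < a k" and mono: "\<And>i j. i \<le> j \<Longrightarrow> a i \<le> a j" and z: "0 \<le> z"
  shows "(\<Sum>k. if 2 ^ Suc k < z then ennreal (a k * 2 ^ k / 2) else 0) \<le> dyadic_young a (ennreal z)"
proof (rule downward_closed_sum_le)
  fix k
  assume "2 ^ Suc (Suc k) < z"
  moreover have "(2::real) ^ Suc k \<le> 2 ^ Suc (Suc k)" by simp
  ultimately show "2 ^ Suc k < z" by linarith
next
  fix n
  assume n: "2 ^ Suc n < z"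
  have "(\<Sum>k\<le>n. ennreal (a k * 2 ^ k / 2)) = ennreal (\<Sum>k\<le>n. a k * 2 ^ k / 2)"
    using a by (intro sum_ennreal) (simp add: less_imp_le)
  also have "\<dots> \<le> ennreal (a n * (z - 2 ^ n))"
  proof (rule ennreal_leI)
    have "(\<Sum>k\<le>n. a k * 2 ^ k / 2) \<le> (\<Sum>k\<le>n. a n * (2 ^ k / 2))"
      using mono by (intro sum_mono) (simp add: mult_right_mono)
    also have "\<dots> = a n * ((\<Sum>k\<le>n. 2 ^ k) / 2)"
      by (simp add: sum_distrib_left sum_divide_distrib)
    also have "(\<Sum>k\<le>n. (2::real) ^ k) = 2 ^ Suc n - 1"
      by (induction n) auto
    also have "a n * ((2 ^ Suc n - 1) / 2) \<le> a n * (z - 2 ^ n)"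
      using n a[of n] by (intro mult_left_mono) (auto simp: field_simps)
    finally show "(\<Sum>k\<le>n. a k * 2 ^ k / 2) \<le> a n * (z - 2 ^ n)" .
  qed
  also have "\<dots> = ennreal (a n) * (ennreal z - ennreal (2 ^ n))"
    using a[of n] by (simp add: ennreal_minus ennreal_mult')
  also have "\<dots> \<le> dyadic_young a (ennreal z)"
    by (rule dyadic_young_ge)
  finally show "(\<Sum>k\<le>n. ennreal (a k * 2 ^ k / 2)) \<le> dyadic_young a (ennreal z)" .
qed

lemma nn_integral_level_series:
  assumes f: "f \<in> borel_measurable unit_leb" and c: "\<And>k. 0 \<le> c k"
  shows "(\<integral>\<^sup>+x. (\<Sum>k. if l k < \<bar>f x\<bar> then ennreal (c k) else 0) \<partial>unit_leb)
    = (\<Sum>k. ennreal (c k * level_measure f (l k)))"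
proof -
  let ?L = "\<lambda>k. {x \<in> space unit_leb. l k < \<bar>f x\<bar>}"
  have "(\<integral>\<^sup>+x. (\<Sum>k. if l k < \<bar>f x\<bar> then ennreal (c k) else 0) \<partial>unit_leb)
    = (\<integral>\<^sup>+x. (\<Sum>k. ennreal (c k) * indicator (?L k) x) \<partial>unit_leb)"
    by (intro nn_integral_cong suminf_cong) (auto simp: indicator_def)
  also have "\<dots> = (\<Sum>k. \<integral>\<^sup>+x. ennreal (c k) * indicator (?L k) x \<partial>unit_leb)"
    using level_set_sets[OF f]
    by (intro nn_integral_suminf borel_measurable_times_ennreal borel_measurable_const
        borel_measurable_indicator) auto
  also have "\<dots> = (\<Sum>k. ennreal (c k * level_measure f (l k)))"
    using level_set_sets[OF f] c
    by (intro suminf_cong) (simp only: nn_integral_cmult_indicator emeasure_level ennreal_mult')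
  finally show ?thesis .
qed

lemma integral_dyadic_young_upper:
  assumes f: "f \<in> borel_measurable unit_leb"
    and a: "\<And>k. 0 < a k" and mono: "\<And>i j. i \<le> j \<Longrightarrow> a i \<le> a j"
  shows "(\<integral>\<^sup>+x. dyadic_young a (ennreal \<bar>f x\<bar>) \<partial>unit_leb)
    \<le> (\<Sum>k. ennreal (2 * (a k * 2 ^ k) * level_measure f (2 ^ k)))"
  using a by (subst nn_integral_level_series[OF f, symmetric])
    (auto intro!: nn_integral_mono dyadic_young_upper mono simp: less_imp_le)

lemma integral_dyadic_young_lower:
  assumes f: "f \<in> borel_measurable unit_leb"
    and a: "\<And>k. 0 < a k" and mono: "\<And>i j. i \<le> j \<Longrightarrow> a i \<le> a j"
  shows "(\<Sum>k. ennreal (a k * 2 ^ k / 2 * level_measure f (2 ^ Suc k)))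
    \<le> (\<integral>\<^sup>+x. dyadic_young a (ennreal \<bar>f x\<bar>) \<partial>unit_leb)"
proof -
  have "(\<Sum>k. ennreal (a k * 2 ^ k / 2 * level_measure f (2 ^ Suc k)))
    = (\<integral>\<^sup>+x. (\<Sum>k. if 2 ^ Suc k < \<bar>f x\<bar> then ennreal (a k * 2 ^ k / 2) else 0) \<partial>unit_leb)"
    using a by (intro nn_integral_level_series[OF f, symmetric]) (simp add: less_imp_le)
  also have "\<dots> \<le> (\<integral>\<^sup>+x. dyadic_young a (ennreal \<bar>f x\<bar>) \<partial>unit_leb)"
    by (intro nn_integral_mono dyadic_young_lower a mono) auto
  finally show ?thesis .
qed

text \<open>
A convergent series of positive terms can be multiplied by a sequence increasing to $\infty$ without
losing convergence: with tails $T_k$, the factor $T_k^{-1/2}$ works, because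
$w_k / \sqrt{T_k} \le 2 (\sqrt{T_k} - \sqrt{T_{k+1}})$ telescopes. This is the discrete form of the
de la Vallee Poussin argument.
\<close>

lemma exists_growth_factor:
  fixes w :: "nat \<Rightarrow> real"
  assumes w: "\<And>k. 0 < w k" and sum: "summable w"
  obtains \<phi> where "\<And>k. 0 < \<phi> k" and "\<And>i j. i \<le> j \<Longrightarrow> \<phi> i \<le> \<phi> j"
    and "filterlim \<phi> at_top sequentially" and "summable (\<lambda>k. w k * \<phi> k)"
proof -
  define T where "T k = (\<Sum>j. w (j + k))" for k
  have T_alt: "T k = suminf w - (\<Sum>j<k. w j)" for k
    unfolding T_def by (rule suminf_minus_initial_segment[OF sum])
  have T_pos: "0 < T k" for k
    unfolding T_def using w by (intro suminf_pos) (auto simp: summable_iff_shift sum)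
  have T_step: "T k - T (Suc k) = w k" for k
    by (simp add: T_alt)
  have T_anti: "T j \<le> T i" if "i \<le> j" for i j
    using that w by (auto simp: T_alt less_imp_le intro: sum_mono2)
  have "T \<longlonglongrightarrow> suminf w - suminf w"
    unfolding T_alt by (intro tendsto_diff tendsto_const summable_LIMSEQ sum)
  then have T_lim: "T \<longlonglongrightarrow> 0" by simp
  then have sqrt_lim: "(\<lambda>k. sqrt (T k)) \<longlonglongrightarrow> 0"
    using tendsto_real_sqrt[of T 0] by simp
  define \<phi> where "\<phi> k = inverse (sqrt (T k))" for k
  show ?thesis
  proof
    show "0 < \<phi> k" for k using T_pos by (simp add: \<phi>_def)
    show "\<phi> i \<le> \<phi> j" if "i \<le> j" for i j
      using T_anti[OF that] T_pos by (simp add: \<phi>_def)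
    show "filterlim \<phi> at_top sequentially"
      unfolding \<phi>_def using sqrt_lim T_pos by (intro filterlim_inverse_at_top) auto
    show "summable (\<lambda>k. w k * \<phi> k)"
    proof (rule summable_comparison_test')
      show "summable (\<lambda>k. 2 * (sqrt (T k) - sqrt (T (Suc k))))"
        by (intro summable_mult telescope_summable'[OF sqrt_lim])
      fix k :: nat
      let ?s = "sqrt (T k)" and ?t = "sqrt (T (Suc k))"
      have st: "0 < ?s" "0 < ?t" "?t \<le> ?s" using T_pos T_anti[of k "Suc k"] by auto
      have "w k = ?s\<^sup>2 - ?t\<^sup>2" using T_step[of k] T_pos by (simp add: less_imp_le)
      also have "\<dots> = (?s - ?t) * (?s + ?t)" by (simp add: power2_eq_square algebra_simps)
      also have "\<dots> \<le> (?s - ?t) * (2 * ?s)" using st by (intro mult_left_mono) auto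
      finally have "w k * \<phi> k \<le> 2 * (?s - ?t)"
        using st by (simp add: \<phi>_def field_simps)
      then show "norm (w k * \<phi> k) \<le> 2 * (?s - ?t)"
        using w[of k] st by (simp add: \<phi>_def abs_mult less_imp_le)
    qed
  qed
qed

section \<open>The case $q \<le> p$\<close>

text \<open>
Substitute for Hoelder's inequality: writing $m^e = v^e (m/v)^e$, the claim is
$(m/v)^e \le 1 + m/v$, which also covers $e = 1$.
\<close>

lemma powr_interpolate:
  fixes m v e :: real
  assumes "0 \<le> m" "0 < v" "0 < e" "e \<le> 1"
  shows "m powr e \<le> v powr e + v powr (e - 1) * m"
proof (cases "m \<le> v")
  case True
  then have "m powr e \<le> v powr e" using assms by (intro powr_mono2) auto
  then show ?thesis using assms by (simp add: add_increasing2)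
next
  case False
  then have "m powr (e - 1) \<le> v powr (e - 1)" using assms by (intro powr_mono2') auto
  then have "m powr (e - 1) * m \<le> v powr (e - 1) * m"
    using assms by (intro mult_right_mono) auto
  moreover have "m powr (e - 1) * m = m powr e"
    using False assms by (simp add: powr_diff)
  ultimately show ?thesis by (simp add: add_increasing)
qed

text \<open>
The levels $m_k(f)$ themselves may vanish for large $k$ and then admit no negative powers. Taking the
maximum with $2^{-2pk}$ makes them positive and adds only a geometric series, as
$2^{kr} (2^{-2pk})^{r/p} = 2^{-kr}$.
\<close>

lemma lorentz_dominating_levels:
  assumes p: "0 < p" and r: "1 \<le> r" and f: "f \<in> borel_measurable unit_leb"
    and fin: "lorentz_int p r f < top"
  obtains \<nu> :: "nat \<Rightarrow> real"
  where "\<And>k. 0 < \<nu> k" and "\<And>i j. i \<le> j \<Longrightarrow> \<nu> j \<le> \<nu> i"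
    and "\<And>k. level_measure f (2 ^ k) \<le> \<nu> k"
    and "summable (\<lambda>k. 2 powr (r * real k) * \<nu> k powr (r / p))"
proof
  let ?m = "\<lambda>k. level_measure f (2 ^ k)"
  define \<nu> where "\<nu> k = max (?m k) (2 powr (- 2 * p * real k))" for k :: nat
  show "0 < \<nu> k" for k by (simp add: \<nu>_def less_max_iff_disj)
  show "\<nu> j \<le> \<nu> i" if "i \<le> j" for i j
    unfolding \<nu>_def using that p by (intro max.mono level_measure_antimono f powr_mono) auto
  show "?m k \<le> \<nu> k" for k by (simp add: \<nu>_def)
  show "summable (\<lambda>k. 2 powr (r * real k) * \<nu> k powr (r / p))"
  proof (rule summable_comparison_test')
    let ?w = "\<lambda>k. 2 powr (r * real k) * ?m k powr (r / p)"
    have "ennreal (p / r) * (\<Sum>k. ennreal (?w k)) < top"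
      using fin by (intro le_less_trans[OF lorentz_int_lower[OF p r f]]) (simp add: ennreal_mult_less_top)
    then have "(\<Sum>k. ennreal (?w k)) \<noteq> top"
      using p r by (auto simp: ennreal_mult_less_top)
    then have "summable ?w"
      by (intro summable_suminf_not_top) auto
    moreover have "summable (\<lambda>k. (2 powr (- r)) ^ k)"
      using r by (intro summable_geometric) (simp add: powr_less_one)
    ultimately show "summable (\<lambda>k. ?w k + (2 powr (- r)) ^ k)"
      by (rule summable_add)
    fix k :: nat
    have "\<nu> k powr (r / p) \<le> ?m k powr (r / p) + (2 powr (- 2 * p * real k)) powr (r / p)"
      unfolding \<nu>_def by (simp add: max_def)
    also have "(2 powr (- 2 * p * real k)) powr (r / p) = 2 powr (- 2 * r * real k)"
      using p by (simp add: powr_powr ac_simps)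
    finally have "2 powr (r * real k) * \<nu> k powr (r / p)
      \<le> 2 powr (r * real k) * (?m k powr (r / p) + 2 powr (- 2 * r * real k))"
      by (intro mult_left_mono) auto
    also have "2 powr (r * real k) * 2 powr (- 2 * r * real k) = (2 powr (- r)) ^ k"
      by (simp add: powr_add[symmetric] powr_powr flip: powr_realpow)
    then have "2 powr (r * real k) * (?m k powr (r / p) + 2 powr (- 2 * r * real k))
      = ?w k + (2 powr (- r)) ^ k"
      by (simp only: distrib_left)
    finally show "norm (2 powr (r * real k) * \<nu> k powr (r / p)) \<le> ?w k + (2 powr (- r)) ^ k"
      by simp
  qed
qed

text \<open>
The heart of the case $q \le p$: the Young function depends only on $f$, and the resulting bound on
dyadic tails is uniform over its modular unit ball and tends to 0.
\<close>

lemma exists_dyadic_young: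
  assumes r: "1 \<le> r" and rp: "r \<le> p" and f: "f \<in> borel_measurable unit_leb"
    and fin: "lorentz_int p r f < top"
  obtains a \<phi> :: "nat \<Rightarrow> real" and S :: real
  where "\<forall>k. 0 < a k" and "0 \<le> S"
    and "(\<integral>\<^sup>+x. dyadic_young a (ennreal \<bar>f x\<bar>) \<partial>unit_leb) < top"
    and "\<forall>k. 0 < \<phi> k" and "filterlim \<phi> at_top sequentially"
    and "\<forall>g N. g \<in> borel_measurable unit_leb \<longrightarrow>
      (\<integral>\<^sup>+x. dyadic_young a (ennreal \<bar>g x\<bar>) \<partial>unit_leb) \<le> 1 \<longrightarrow>
      (\<Sum>k. ennreal (2 powr (r * real (N + k)) * level_measure g (2 ^ Suc (N + k)) powr (r / p)))
        \<le> ennreal (S / \<phi> N)"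
proof -
  have p: "0 < p" using r rp by linarith
  have e: "0 < r / p" "r / p \<le> 1" using p r rp by auto
  obtain \<nu> where \<nu>: "\<And>k. 0 < \<nu> k" "\<And>i j. i \<le> j \<Longrightarrow> \<nu> j \<le> \<nu> i"
    "\<And>k. level_measure f (2 ^ k) \<le> \<nu> k"
    "summable (\<lambda>k. 2 powr (r * real k) * \<nu> k powr (r / p))"
    using lorentz_dominating_levels[OF p r f fin] by blast
  define w where "w k = 2 powr (r * real k) * \<nu> k powr (r / p)" for k
  have w: "0 < w k" for k using \<nu>(1)[of k] by (simp add: w_def)
  obtain \<phi> where \<phi>: "\<And>k. 0 < \<phi> k" "\<And>i j. i \<le> j \<Longrightarrow> \<phi> i \<le> \<phi> j"
    "filterlim \<phi> at_top sequentially" "summable (\<lambda>k. w k * \<phi> k)"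
    using exists_growth_factor[of w, OF w] \<nu>(4) unfolding w_def by blast
  \<comment> \<open>The slopes are chosen so that \<open>2 ^ k * a k * \<nu> k = w k * \<phi> k\<close>.\<close>
  define a where "a k = 2 powr ((r - 1) * real k) * \<nu> k powr (r / p - 1) * \<phi> k" for k
  have a: "0 < a k" for k using \<nu>(1)[of k] \<phi>(1)[of k] by (simp add: a_def)
  have a_mono: "a i \<le> a j" if "i \<le> j" for i j
    unfolding a_def using that r e \<nu>(1)[of i] \<nu>(1)[of j] \<nu>(2)[OF that] \<phi>(1)[of i] \<phi>(2)[OF that]
    by (intro mult_mono powr_mono powr_mono2') auto
  have a_\<nu>: "a k * 2 ^ k = 2 powr (r * real k) * \<nu> k powr (r / p - 1) * \<phi> k" for k
  proof -
    have "2 powr ((r - 1) * real k) * 2 ^ k = 2 powr (r * real k)"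
      by (simp add: powr_add[symmetric] algebra_simps flip: powr_realpow)
    then show ?thesis by (simp add: a_def mult.commute mult.left_commute)
  qed
  have aw: "a k * 2 ^ k * \<nu> k = w k * \<phi> k" for k
  proof -
    have "\<nu> k powr (r / p - 1) * \<nu> k = \<nu> k powr (r / p)"
      using \<nu>(1)[of k] by (simp add: powr_diff)
    then show ?thesis by (simp add: a_\<nu> w_def ac_simps)
  qed
  define W where "W = (\<Sum>k. w k * \<phi> k)"
  have w\<phi>: "0 \<le> w k * \<phi> k" for k using w[of k] \<phi>(1)[of k] by simp
  have W0: "0 \<le> W" unfolding W_def by (rule suminf_nonneg[OF \<phi>(4) w\<phi>])
  have W: "(\<Sum>k. ennreal (w k * \<phi> k)) = ennreal W"
    unfolding W_def by (rule suminf_ennreal2[OF w\<phi> \<phi>(4)])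
  show ?thesis
  proof
    show "\<forall>k. 0 < a k" using a by blast
    show "0 \<le> W + 2" using W0 by simp
    show "\<forall>k. 0 < \<phi> k" using \<phi>(1) by blast
    show "filterlim \<phi> at_top sequentially" by (rule \<phi>(3))
    have "(\<integral>\<^sup>+x. dyadic_young a (ennreal \<bar>f x\<bar>) \<partial>unit_leb)
      \<le> (\<Sum>k. ennreal (2 * (a k * 2 ^ k) * level_measure f (2 ^ k)))"
      by (rule integral_dyadic_young_upper[OF f a a_mono])
    also have "\<dots> \<le> (\<Sum>k. ennreal 2 * ennreal (w k * \<phi> k))"
    proof (intro suminf_le summableI)
      fix k
      have "2 * (a k * 2 ^ k) * level_measure f (2 ^ k) \<le> 2 * (a k * 2 ^ k) * \<nu> k"
        using a[of k] by (intro mult_left_mono \<nu>(3)) auto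
      also have "\<dots> = 2 * (w k * \<phi> k)"
        using aw[of k] by simp
      finally show "ennreal (2 * (a k * 2 ^ k) * level_measure f (2 ^ k)) \<le> ennreal 2 * ennreal (w k * \<phi> k)"
        using w\<phi>[of k] by (simp only: ennreal_leI flip: ennreal_mult')
    qed
    also have "\<dots> < top"
      unfolding ennreal_suminf_cmult W by (simp add: ennreal_mult_less_top)
    finally show "(\<integral>\<^sup>+x. dyadic_young a (ennreal \<bar>f x\<bar>) \<partial>unit_leb) < top" .
    show "\<forall>g N. g \<in> borel_measurable unit_leb \<longrightarrow>
      (\<integral>\<^sup>+x. dyadic_young a (ennreal \<bar>g x\<bar>) \<partial>unit_leb) \<le> 1 \<longrightarrow>
      (\<Sum>k. ennreal (2 powr (r * real (N + k)) * level_measure g (2 ^ Suc (N + k)) powr (r / p)))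
        \<le> ennreal ((W + 2) / \<phi> N)"
    proof (intro allI impI)
      fix g :: "real \<Rightarrow> real" and N
      assume g: "g \<in> borel_measurable unit_leb"
        and g1: "(\<integral>\<^sup>+x. dyadic_young a (ennreal \<bar>g x\<bar>) \<partial>unit_leb) \<le> 1"
      let ?m = "\<lambda>k. level_measure g (2 ^ Suc k)"
      let ?v = "\<lambda>k. ennreal (a k * 2 ^ k / 2 * ?m k)"
      have v: "suminf ?v \<le> 1"
        by (rule order_trans[OF integral_dyadic_young_lower[OF g a a_mono] g1])
      have bound: "ennreal (2 powr (r * real (N + k)) * ?m (N + k) powr (r / p))
        \<le> ennreal (1 / \<phi> N) * (ennreal (w (k + N) * \<phi> (k + N)) + 2 * ?v (k + N))" for k
      proof -
        define j where "j = k + N"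
        have "2 powr (r * real j) * ?m j powr (r / p)
          \<le> 2 powr (r * real j) * (\<nu> j powr (r / p) + \<nu> j powr (r / p - 1) * ?m j)"
          using e \<nu>(1) by (intro mult_left_mono powr_interpolate) auto
        also have "\<dots> = (1 / \<phi> j) * (w j * \<phi> j + a j * 2 ^ j * ?m j)"
          using \<phi>(1)[of j] by (simp add: a_\<nu> w_def field_simps)
        also have "\<dots> \<le> (1 / \<phi> N) * (w j * \<phi> j + a j * 2 ^ j * ?m j)"
        proof (rule mult_right_mono)
          show "1 / \<phi> j \<le> 1 / \<phi> N"
            using \<phi>(2)[of N j] \<phi>(1)[of N] by (intro frac_le) (auto simp: j_def)
          show "0 \<le> w j * \<phi> j + a j * 2 ^ j * ?m j"
            using a[of j] by (intro add_nonneg_nonneg w\<phi>) (simp add: less_imp_le)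
        qed
        finally have "ennreal (2 powr (r * real j) * ?m j powr (r / p))
          \<le> ennreal ((1 / \<phi> N) * (w j * \<phi> j + a j * 2 ^ j * ?m j))"
          by (rule ennreal_leI)
        also have "\<dots> = ennreal (1 / \<phi> N) * (ennreal (w j * \<phi> j) + ennreal (a j * 2 ^ j * ?m j))"
          using \<phi>(1)[of N] w\<phi>[of j] a[of j]
          by (subst ennreal_mult') (auto simp: less_imp_le intro!: arg_cong2[of _ _ _ _ "(*)"] ennreal_plus)
        also have "ennreal (a j * 2 ^ j * ?m j) = ennreal 2 * ?v j"
          by (subst ennreal_mult'[symmetric]) auto
        finally show ?thesis by (simp add: j_def add.commute)
      qed
      have "(\<Sum>k. ennreal (2 powr (r * real (N + k)) * ?m (N + k) powr (r / p)))
        \<le> (\<Sum>k. ennreal (1 / \<phi> N) * (ennreal (w (k + N) * \<phi> (k + N)) + 2 * ?v (k + N)))"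
        by (intro suminf_le summableI bound)
      also have "\<dots> = ennreal (1 / \<phi> N) * ((\<Sum>k. ennreal (w (k + N) * \<phi> (k + N))) + 2 * (\<Sum>k. ?v (k + N)))"
        by (simp only: ennreal_suminf_cmult suminf_add[OF summableI summableI, symmetric])
      also have "\<dots> \<le> ennreal (1 / \<phi> N) * (ennreal W + 2 * 1)"
      proof (intro mult_left_mono add_mono)
        show "(\<Sum>k. ennreal (w (k + N) * \<phi> (k + N))) \<le> ennreal W"
          unfolding W[symmetric] suminf_offset[OF summableI, of "\<lambda>k. ennreal (w k * \<phi> k)" N]
          by (rule add_increasing2) auto
        have "(\<Sum>k. ?v (k + N)) \<le> suminf ?v"
          unfolding suminf_offset[OF summableI, of ?v N] by (rule add_increasing2) auto
        then show "(\<Sum>k. ?v (k + N)) \<le> 1" using v by (rule order_trans)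
      qed auto
      also have "\<dots> = ennreal ((W + 2) / \<phi> N)"
      proof -
        have eq: "ennreal W + 2 * 1 = ennreal (W + 2)"
          using W0 by (simp add: ennreal_plus)
        show ?thesis
          unfolding eq using \<phi>(1)[of N] by (subst ennreal_mult'[symmetric]) auto
      qed
      finally show "(\<Sum>k. ennreal (2 powr (r * real (N + k)) * ?m (N + k) powr (r / p)))
        \<le> ennreal ((W + 2) / \<phi> N)" .
    qed
  qed
qed

lemma luxemburg_lessD:
  assumes "luxemburg A f < ennreal c"
  obtains l where "0 < l" and "l < c" and "(\<integral>\<^sup>+x. A (ennreal (\<bar>f x\<bar> / l)) \<partial>unit_leb) \<le> 1"
proof -
  obtain l where "0 < l" "ennreal l < ennreal c" "(\<integral>\<^sup>+x. A (ennreal (\<bar>f x\<bar> / l)) \<partial>unit_leb) \<le> 1"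
    using assms unfolding luxemburg_def by (auto simp: Inf_less_iff)
  then show ?thesis using that by (simp add: ennreal_less_iff)
qed

lemma luxemburg_finiteD:
  assumes "luxemburg A f < top"
  obtains l where "0 < l" and "(\<integral>\<^sup>+x. A (ennreal (\<bar>f x\<bar> / l)) \<partial>unit_leb) \<le> 1"
  using assms unfolding luxemburg_def by (auto simp: Inf_less_iff)

lemma luxemburg_leI:
  assumes "0 < l" and "(\<integral>\<^sup>+x. A (ennreal (\<bar>f x\<bar> / l)) \<partial>unit_leb) \<le> 1"
  shows "luxemburg A f \<le> ennreal l"
  unfolding luxemburg_def using assms by (intro Inf_lower) auto

text \<open>
By convexity and $A(0) = 0$, division of $f$ by $l \ge 1$ divides the modular by at least $l$, so a
finite modular can be brought below 1.
\<close>

lemma finite_integral_imp_fspace_luxemburg: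
  assumes f: "f \<in> borel_measurable unit_leb"
    and fin: "(\<integral>\<^sup>+x. dyadic_young a (ennreal \<bar>f x\<bar>) \<partial>unit_leb) < top"
  shows "f \<in> fspace (luxemburg (dyadic_young a))"
proof -
  let ?A = "dyadic_young a"
  have meas: "(\<lambda>x. ?A (ennreal \<bar>f x\<bar>)) \<in> borel_measurable unit_leb"
    unfolding dyadic_young_def using f by measurable
  obtain I where I: "0 \<le> I" "(\<integral>\<^sup>+x. ?A (ennreal \<bar>f x\<bar>) \<partial>unit_leb) = ennreal I"
    using fin unfolding less_top_ennreal by blast
  define l where "l = max 1 I"
  have l: "1 \<le> l" "I \<le> l" by (auto simp: l_def)
  have "(\<integral>\<^sup>+x. ?A (ennreal (\<bar>f x\<bar> / l)) \<partial>unit_leb)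
    \<le> (\<integral>\<^sup>+x. ennreal (1 / l) * ?A (ennreal \<bar>f x\<bar>) \<partial>unit_leb)"
    using l by (intro nn_integral_mono dyadic_young_scale) auto
  also have "\<dots> = ennreal (1 / l) * ennreal I"
    unfolding nn_integral_cmult[OF meas] I ..
  also have "\<dots> \<le> 1"
    using l I by (simp flip: ennreal_mult' add: ennreal_le_1)
  finally have "luxemburg ?A f \<le> ennreal l"
    using l by (intro luxemburg_leI) auto
  then show ?thesis
    using f by (auto simp: fspace_def intro: le_less_trans)
qed

lemma embeds_imp_subset:
  assumes "embeds X Y"
  shows "fspace X \<subseteq> fspace Y"
proof
  fix f assume f: "f \<in> fspace X"
  obtain C :: real where "Y f \<le> ennreal C * X f"
    using assms f unfolding embeds_def by blast
  also have "\<dots> < top" using f by (auto simp: fspace_def ennreal_mult_less_top)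
  finally show "f \<in> fspace Y" using f by (simp add: fspace_def)
qed

text \<open>
Apply almost-compactness to $E_n = \{|g| > n\}$ for a multiple $g$ of $f$ in the unit ball: some
truncation $g \chi_{E_n}$ lies in $L^{p,q}$, and it carries all large values of $g$.
\<close>

lemma embeds_ac_luxemburg_lorentz_subset:
  assumes p: "0 < p" and r: "1 \<le> r" and ac: "embeds_ac (luxemburg A) (lorentz p (ennreal r))"
  shows "fspace (luxemburg A) \<subseteq> fspace (lorentz p (ennreal r))"
proof
  fix f assume f: "f \<in> fspace (luxemburg A)"
  have r0: "0 < r" using r by simp
  have f_meas: "f \<in> borel_measurable unit_leb" using f by (simp add: fspace_def)
  obtain l where l: "0 < l" "(\<integral>\<^sup>+x. A (ennreal (\<bar>f x\<bar> / l)) \<partial>unit_leb) \<le> 1"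
    using f by (auto simp: fspace_def elim: luxemburg_finiteD)
  define g where "g x = f x / l" for x
  have g: "g \<in> borel_measurable unit_leb"
    unfolding g_def using f_meas by measurable
  have g1: "luxemburg A g \<le> 1"
    using luxemburg_leI[of 1 A g] l by (simp add: g_def)
  define E where "E n = {x \<in> space unit_leb. real n < \<bar>g x\<bar>}" for n :: nat
  have E: "E n \<in> sets unit_leb" for n
    unfolding E_def by (rule level_set_sets[OF g])
  have "(\<lambda>n. indicat_real (E n) x) \<longlonglongrightarrow> 0" for x
  proof (rule tendsto_eventually)
    obtain N where "\<bar>g x\<bar> \<le> real N" using real_arch_simple by blast
    then show "eventually (\<lambda>n. indicat_real (E n) x = 0) sequentially"
      by (intro eventually_sequentiallyI[of N]) (auto simp: E_def indicator_def)
  qed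
  then have "(\<lambda>n. SUP h\<in>{h \<in> borel_measurable unit_leb. luxemburg A h \<le> 1}.
      lorentz p (ennreal r) (\<lambda>x. h x * indicat_real (E n) x)) \<longlonglongrightarrow> 0"
    using ac E unfolding embeds_ac_def by simp
  then have "eventually (\<lambda>n. (SUP h\<in>{h \<in> borel_measurable unit_leb. luxemburg A h \<le> 1}.
      lorentz p (ennreal r) (\<lambda>x. h x * indicat_real (E n) x)) < 1) sequentially"
    by (rule order_tendstoD) simp
  then obtain n where n: "(SUP h\<in>{h \<in> borel_measurable unit_leb. luxemburg A h \<le> 1}.
      lorentz p (ennreal r) (\<lambda>x. h x * indicat_real (E n) x)) < 1"
    by (auto simp: eventually_sequentially)
  have "lorentz p (ennreal r) (\<lambda>x. g x * indicat_real (E n) x) < 1"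
    by (rule le_less_trans[OF SUP_upper n]) (use g g1 in auto)
  then have "lorentz p (ennreal r) (\<lambda>x. g x * indicat_real (E n) x) < top"
    by (rule less_trans) simp
  then have "lorentz_int p r (\<lambda>x. g x * indicat_real (E n) x) < top"
    by (simp add: lorentz_finite_index[OF r0] epowr_less_top_iff)
  moreover have "(\<lambda>x. g x * indicat_real (E n) x) \<in> borel_measurable unit_leb"
    by (intro borel_measurable_times g borel_measurable_indicator E)
  ultimately have "lorentz_int p r g < top"
    using lorentz_int_finite_if_large_part[OF p r g _ E_def] by blast
  then have "lorentz p (ennreal r) g < top"
    by (simp add: lorentz_finite_index[OF r0] epowr_less_top_iff)
  then have "lorentz p (ennreal r) f < top"
    using lorentz_scale_le[OF l(1) r0, of p f]
    by (auto simp: g_def[abs_def] ennreal_mult_less_top intro: le_less_trans)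
  then show "f \<in> fspace (lorentz p (ennreal r))"
    using f_meas by (simp add: fspace_def)
qed

lemma measure_tendsto_0_if_indicator:
  assumes E: "\<And>n. E n \<in> sets unit_leb"
    and lim: "AE x in unit_leb. (\<lambda>n. indicat_real (E n) x) \<longlonglongrightarrow> 0"
  shows "(\<lambda>n. measure unit_leb (E n)) \<longlonglongrightarrow> 0"
proof -
  have "(\<lambda>n. \<integral>x. indicat_real (E n) x \<partial>unit_leb) \<longlonglongrightarrow> (\<integral>x. 0 \<partial>unit_leb)"
    using lim
  proof (rule integral_dominated_convergence[where w = "\<lambda>_. 1", rotated -2])
    show "AE x in unit_leb. norm (indicat_real (E n) x) \<le> 1" for n
      by (simp add: indicator_def)
    show "integrable unit_leb (\<lambda>_. 1 :: real)"
      by (rule finite_measure.integrable_const[OF finite_unit_leb])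
  qed (use E in \<open>auto intro: borel_measurable_indicator\<close>)
  then show ?thesis
    using E sets.sets_into_space[OF E] by (simp add: Int_absorb2)
qed

text \<open>
With $B\,N\,e$ the bound for functions of support at most $e$, the choice $N = 0$, $e = 1$ gives the
embedding. For almost-compactness, first $N$ makes the tail small, then $|E_n| \to 0$ makes the finitely
many remaining levels small. The unit ball of the Luxemburg norm is halved so that its elements have
modular at most 1 without attaining the infimum in the norm.
\<close>

lemma exists_young_between:
  assumes r: "1 \<le> r" and rp: "r \<le> p" and f: "f \<in> fspace (lorentz p (ennreal r))"
  shows "\<exists>A. young A \<and> f \<in> fspace (luxemburg A) \<and>
    embeds (luxemburg A) (lorentz p (ennreal r)) \<and> embeds_ac (luxemburg A) (lorentz p (ennreal r))"
proof -
  have p: "0 < p" and r0: "0 < r" using r rp by auto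
  have f_meas: "f \<in> borel_measurable unit_leb" and fin: "lorentz_int p r f < top"
    using f by (auto simp: fspace_lorentz_iff[OF r0])
  obtain a \<phi> S where a: "\<forall>k. 0 < a k" and S: "0 \<le> S"
    and fA: "(\<integral>\<^sup>+x. dyadic_young a (ennreal \<bar>f x\<bar>) \<partial>unit_leb) < top"
    and \<phi>: "\<forall>k. 0 < \<phi> k" "filterlim \<phi> at_top sequentially"
    and tail: "\<forall>g N. g \<in> borel_measurable unit_leb \<longrightarrow>
      (\<integral>\<^sup>+x. dyadic_young a (ennreal \<bar>g x\<bar>) \<partial>unit_leb) \<le> 1 \<longrightarrow>
      (\<Sum>k. ennreal (2 powr (r * real (N + k)) * level_measure g (2 ^ Suc (N + k)) powr (r / p)))
        \<le> ennreal (S / \<phi> N)"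
    by (rule exists_dyadic_young[OF r rp f_meas fin])
  let ?A = "dyadic_young a"
  let ?Y = "lorentz p (ennreal r)"
  define B where "B N e = p / r * ((1 + (\<Sum>k\<le>N. 2 powr (r * real (Suc k)))) * e powr (r / p)
    + 4 powr r * (S / \<phi> N))" for N e
  have B0: "0 \<le> B N e" for N e
    unfolding B_def using p r0 S \<phi>(1)[rule_format, of N] by (intro mult_nonneg_nonneg add_nonneg_nonneg sum_nonneg) auto
  have bound: "?Y g \<le> ennreal (B N e powr (1 / r))"
    if "g \<in> borel_measurable unit_leb" "(\<integral>\<^sup>+x. ?A (ennreal \<bar>g x\<bar>) \<partial>unit_leb) \<le> 1"
      "level_measure g 0 \<le> e" for g N e
  proof -
    have "lorentz_int p r g \<le> ennreal (B N e)"
      unfolding B_def using S \<phi>(1)[rule_format, of N]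
      by (intro lorentz_int_tail_bound p r0 that tail[rule_format]) auto
    then have "epowr (lorentz_int p r g) (1 / r) \<le> epowr (ennreal (B N e)) (1 / r)"
      using r0 by (intro epowr_mono) auto
    then show ?thesis
      using B0 by (simp add: lorentz_finite_index[OF r0] epowr_ennreal)
  qed
  have emb: "embeds (luxemburg ?A) ?Y"
    unfolding embeds_def
  proof (intro exI conjI ballI)
    let ?C = "B 0 1 powr (1 / r) + 1"
    have "0 \<le> B 0 1 powr (1 / r)" by simp
    then show C: "0 < ?C" by linarith
    fix g
    assume "g \<in> fspace (luxemburg ?A)"
    then have g: "g \<in> borel_measurable unit_leb" by (simp add: fspace_def)
    show "?Y g \<le> ennreal ?C * luxemburg ?A g"
      unfolding luxemburg_def
    proof (rule le_ennreal_mult_InfI[OF C], clarify)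
      fix l :: real
      assume l: "0 < l" "(\<integral>\<^sup>+x. ?A (ennreal (\<bar>g x\<bar> / l)) \<partial>unit_leb) \<le> 1"
      have "?Y (\<lambda>x. g x / l) \<le> ennreal (B 0 1 powr (1 / r))"
      proof (rule bound)
        show "(\<lambda>x. g x / l) \<in> borel_measurable unit_leb" using g by measurable
        show "(\<integral>\<^sup>+x. ?A (ennreal \<bar>g x / l\<bar>) \<partial>unit_leb) \<le> 1" using l by simp
      qed (rule level_measure_le_1)
      also have "\<dots> \<le> ennreal ?C" by (intro ennreal_leI) simp
      finally have "ennreal l * ?Y (\<lambda>x. g x / l) \<le> ennreal l * ennreal ?C"
        by (rule mult_left_mono) simp
      then show "?Y g \<le> ennreal ?C * ennreal l"
        using lorentz_scale_le[OF l(1) r0, of p g] by (simp add: mult.commute)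
    qed
  qed
  have ac: "embeds_ac (luxemburg ?A) ?Y"
    unfolding embeds_ac_def
  proof (intro allI impI)
    fix E :: "nat \<Rightarrow> real set"
    assume E: "\<forall>n. E n \<in> sets unit_leb"
      and lim: "AE x in unit_leb. (\<lambda>n. indicat_real (E n) x) \<longlonglongrightarrow> 0"
    define e where "e n = measure unit_leb (E n)" for n
    have e_lim: "e \<longlonglongrightarrow> 0"
      unfolding e_def using E lim by (intro measure_tendsto_0_if_indicator) auto
    let ?F = "{h \<in> borel_measurable unit_leb. luxemburg ?A h \<le> 1}"
    have small: "eventually (\<lambda>n. (SUP h\<in>?F. ?Y (\<lambda>x. h x * indicat_real (E n) x)) \<le> ennreal \<eta>) sequentially"
      if \<eta>: "0 < \<eta>" for \<eta>
    proof -
      define \<delta> where "\<delta> = (\<eta> / 2) powr r"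
      have \<delta>: "0 < \<delta>" using \<eta> by (simp add: \<delta>_def)
      have "(\<lambda>N. S / \<phi> N) \<longlonglongrightarrow> 0"
        by (rule tendsto_divide_0[OF tendsto_const filterlim_at_top_imp_at_infinity[OF \<phi>(2)]])
      then have "(\<lambda>N. p / r * (0 + 4 powr r * (S / \<phi> N))) \<longlonglongrightarrow> p / r * (0 + 4 powr r * 0)"
        by (intro tendsto_intros)
      then have "eventually (\<lambda>N. p / r * (0 + 4 powr r * (S / \<phi> N)) < \<delta>) sequentially"
        using \<delta> by (intro order_tendstoD) auto
      then obtain N where N: "p / r * (0 + 4 powr r * (S / \<phi> N)) < \<delta>"
        by (auto simp: eventually_sequentially)
      have "(\<lambda>n. e n powr (r / p)) \<longlonglongrightarrow> 0"
        using p r0 by (intro tendsto_zero_powrI[OF e_lim tendsto_const]) (auto simp: e_def)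
      then have "(\<lambda>n. B N (e n)) \<longlonglongrightarrow> p / r * ((1 + (\<Sum>k\<le>N. 2 powr (r * real (Suc k)))) * 0
        + 4 powr r * (S / \<phi> N))"
        unfolding B_def by (intro tendsto_intros)
      then have "eventually (\<lambda>n. B N (e n) < \<delta>) sequentially"
        using N by (intro order_tendstoD) auto
      then show ?thesis
      proof eventually_elim
        case (elim n)
        show ?case
        proof (rule SUP_least, clarify)
          fix h
          assume h: "h \<in> borel_measurable unit_leb" "luxemburg ?A h \<le> 1"
          let ?g = "\<lambda>x. h x * indicat_real (E n) x"
          have "luxemburg ?A h < ennreal 2"
            by (rule le_less_trans[OF h(2)]) (simp add: ennreal_less_iff flip: ennreal_1)
          then obtain l where l: "0 < l" "l < 2" "(\<integral>\<^sup>+x. ?A (ennreal (\<bar>h x\<bar> / l)) \<partial>unit_leb) \<le> 1"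
            by (rule luxemburg_lessD)
          have g: "(\<lambda>x. ?g x / 2) \<in> borel_measurable unit_leb"
            using E h by (intro borel_measurable_divide borel_measurable_times borel_measurable_indicator
                borel_measurable_const) auto
          have "?Y (\<lambda>x. ?g x / 2) \<le> ennreal (B N (e n) powr (1 / r))"
          proof (rule bound[OF g])
            have "(\<integral>\<^sup>+x. ?A (ennreal \<bar>?g x / 2\<bar>) \<partial>unit_leb)
              \<le> (\<integral>\<^sup>+x. ?A (ennreal (\<bar>h x\<bar> / l)) \<partial>unit_leb)"
            proof (intro nn_integral_mono dyadic_young_mono ennreal_leI)
              fix x
              have "\<bar>?g x / 2\<bar> \<le> \<bar>h x\<bar> / 2" by (simp add: indicator_def)
              also have "\<dots> \<le> \<bar>h x\<bar> / l" using l by (intro divide_left_mono) auto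
              finally show "\<bar>?g x / 2\<bar> \<le> \<bar>h x\<bar> / l" .
            qed
            then show "(\<integral>\<^sup>+x. ?A (ennreal \<bar>?g x / 2\<bar>) \<partial>unit_leb) \<le> 1"
              using l(3) by (rule order_trans)
            show "level_measure (\<lambda>x. ?g x / 2) 0 \<le> e n"
              unfolding level_measure_def e_def
              by (rule finite_measure.finite_measure_mono[OF finite_unit_leb])
                 (use E in \<open>auto simp: indicator_def split: if_splits\<close>)
          qed
          also have "\<dots> \<le> ennreal (\<delta> powr (1 / r))"
            using elim B0[of N "e n"] r0 by (intro ennreal_leI powr_mono2) auto
          also have "\<delta> powr (1 / r) = \<eta> / 2"
            using \<eta> r0 by (simp add: \<delta>_def powr_powr)
          finally have "ennreal 2 * ?Y (\<lambda>x. ?g x / 2) \<le> ennreal 2 * ennreal (\<eta> / 2)"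
            by (rule mult_left_mono) simp
          also have "\<dots> = ennreal \<eta>"
            using \<eta> by (subst ennreal_mult'[symmetric]) auto
          finally show "?Y ?g \<le> ennreal \<eta>"
            using lorentz_scale_le[of 2 r p ?g] r0 by (auto intro: order_trans)
        qed
      qed
    qed
    show "(\<lambda>n. SUP h\<in>?F. ?Y (\<lambda>x. h x * indicat_real (E n) x)) \<longlonglongrightarrow> 0"
    proof (rule order_tendstoI)
      fix c :: ennreal
      assume "0 < c"
      then obtain y where y: "0 < y" "y < c" using dense by blast
      then obtain \<eta> where "y = ennreal \<eta>" "0 < \<eta>"
        by (cases y) (auto simp: ennreal_less_iff top.extremum_strict)
      then show "eventually (\<lambda>n. (SUP h\<in>?F. ?Y (\<lambda>x. h x * indicat_real (E n) x)) < c) sequentially"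
        using small[of \<eta>] y by (auto elim!: eventually_mono intro: le_less_trans)
    qed simp
  qed
  show ?thesis
    by (intro exI[of _ ?A] conjI young_dyadic_young emb ac
        finite_integral_imp_fspace_luxemburg[OF f_meas fA] a[rule_format])
qed

lemma sub_diagonal_lorentz:
  assumes r: "1 \<le> r" and rp: "r \<le> p"
  shows "sub_diagonal (lorentz p (ennreal r))" and "uniformly_sub_diagonal (lorentz p (ennreal r))"
proof -
  let ?Y = "lorentz p (ennreal r)"
  have p: "0 < p" using r rp by linarith
  show "sub_diagonal ?Y"
    unfolding sub_diagonal_def
  proof (intro equalityI subsetI)
    fix f assume "f \<in> fspace ?Y"
    from exists_young_between[OF r rp this]
    show "f \<in> \<Union> {fspace (luxemburg A) | A. young A \<and> embeds (luxemburg A) ?Y}" by blast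
  next
    fix f assume "f \<in> \<Union> {fspace (luxemburg A) | A. young A \<and> embeds (luxemburg A) ?Y}"
    then obtain A where "f \<in> fspace (luxemburg A)" "embeds (luxemburg A) ?Y" by blast
    then show "f \<in> fspace ?Y" using embeds_imp_subset by blast
  qed
  show "uniformly_sub_diagonal ?Y"
    unfolding uniformly_sub_diagonal_def
  proof (intro equalityI subsetI)
    fix f assume "f \<in> fspace ?Y"
    from exists_young_between[OF r rp this]
    show "f \<in> \<Union> {fspace (luxemburg A) | A. young A \<and> embeds_ac (luxemburg A) ?Y}" by blast
  next
    fix f assume "f \<in> \<Union> {fspace (luxemburg A) | A. young A \<and> embeds_ac (luxemburg A) ?Y}"
    then obtain A where "f \<in> fspace (luxemburg A)" "embeds_ac (luxemburg A) ?Y" by blast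
    then show "f \<in> fspace ?Y" using embeds_ac_luxemburg_lorentz_subset[OF p r] by blast
  qed
qed

section \<open>The case $p < q$\<close>

text \<open>
An element of $L^{p,q}$ for every $q > p$ that is not in $L^p$: the logarithm is just strong enough for
$\int_0^1 (1 - \ln t)^{-q/p}\,dt/t$ to converge when $q > p$ and to diverge when $q = p$.
\<close>

definition critical :: "real \<Rightarrow> real \<Rightarrow> real" where
  "critical p t = (t * (1 - ln t)) powr (- 1 / p)"

lemma one_minus_ln_ge_1: "0 < t \<Longrightarrow> t \<le> 1 \<Longrightarrow> 1 \<le> 1 - ln t" for t :: real
  by simp

lemma ln_less_1: "0 < t \<Longrightarrow> t \<le> 1 \<Longrightarrow> ln t < 1" for t :: real
  by (rule le_less_trans[of _ 0]) auto

lemma x_one_minus_ln_pos: "0 < t \<Longrightarrow> t \<le> 1 \<Longrightarrow> 0 < t * (1 - ln t)" for t :: real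
  using one_minus_ln_ge_1[of t] by (intro mult_pos_pos) linarith+

lemma x_one_minus_ln_mono:
  fixes s t :: real
  assumes "0 < s" "s \<le> t" "t \<le> 1"
  shows "s * (1 - ln s) \<le> t * (1 - ln t)"
proof (rule DERIV_nonneg_imp_nondecreasing[OF assms(2)])
  fix x assume x: "s \<le> x" "x \<le> t"
  have "((\<lambda>x. x * (1 - ln x)) has_real_derivative - ln x) (at x)"
    using x assms by (auto intro!: derivative_eq_intros)
  moreover have "0 \<le> - ln x" using x assms by simp
  ultimately show "\<exists>y. ((\<lambda>x. x * (1 - ln x)) has_real_derivative y) (at x) \<and> 0 \<le> y" by blast
qed

lemma critical_antimono:
  assumes "0 < p" "0 < s" "s \<le> t" "t \<le> 1"
  shows "critical p t \<le> critical p s"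
  unfolding critical_def
  using assms x_one_minus_ln_mono[of s t] x_one_minus_ln_pos[of s] by (intro powr_mono2') auto

lemma critical_pos: "0 < t \<Longrightarrow> t \<le> 1 \<Longrightarrow> 0 < critical p t"
  using x_one_minus_ln_pos[of t] by (auto simp: critical_def)

lemma critical_borel: "critical p \<in> borel_measurable unit_leb"
proof -
  have "critical p \<in> borel_measurable borel"
    unfolding critical_def[abs_def] by measurable
  then show ?thesis
    by (intro measurable_restrict_space1 measurable_completion) simp
qed

lemma measure_unit_leb_Ioo:
  assumes "0 \<le> m" "m \<le> 1"
  shows "measure unit_leb {0<..<m} = m"
  using assms by (subst measure_restrict_space) auto

lemma Ioo_sets_unit_leb: "m \<le> 1 \<Longrightarrow> {0<..<m} \<in> sets unit_leb"
  by (auto simp: sets_restrict_space_iff)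

lemma rearr_critical_le:
  assumes p: "0 < p" and t: "0 < t" "t < 1"
  shows "rearr (critical p) t \<le> ennreal (critical p t)"
proof (rule rearr_le)
  have "{x \<in> space unit_leb. critical p t < \<bar>critical p x\<bar>} \<subseteq> {0<..<t}"
    using critical_antimono[OF p t(1)] critical_pos[of _ p] by (fastforce simp: not_less[symmetric])
  then have "level_measure (critical p) (critical p t) \<le> measure unit_leb {0<..<t}"
    unfolding level_measure_def using t
    by (intro finite_measure.finite_measure_mono[OF finite_unit_leb] Ioo_sets_unit_leb) auto
  then show "level_measure (critical p) (critical p t) \<le> t"
    using measure_unit_leb_Ioo[of t] t by simp
  show "0 \<le> critical p t" using critical_pos[of t p] t by simp
qed

lemma rearr_eq_0: "1 \<le> t \<Longrightarrow> rearr f t = 0"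
  using rearr_le[of f 0 t] level_measure_le_1[of f 0] by simp

text \<open>
The primitive is $(1 - \ln t)^{1-e} / (e - 1)$, which extends continuously by 0 to $t = 0$.
\<close>

lemma nn_integral_log_weight_finite:
  fixes e :: real
  assumes e: "1 < e"
  shows "(\<integral>\<^sup>+t. ennreal (1 / t * (1 - ln t) powr (- e)) * indicator {0<..<1} t \<partial>lborel) < top"
proof -
  define F where "F t = (if t \<le> 0 then 0 else (1 - ln t) powr (1 - e) / (e - 1))" for t :: real
  have "((\<lambda>t. 1 / t * (1 - ln t) powr (- e)) has_integral (F 1 - F 0)) {0..1}"
  proof (rule fundamental_theorem_of_calculus_interior)
    show "continuous_on {0..1} F"
      unfolding continuous_on_def
    proof
      fix x :: real
      assume x: "x \<in> {0..1}"
      show "(F \<longlongrightarrow> F x) (at x within {0..1})"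
      proof (cases "x = 0")
        case True
        have "filterlim (\<lambda>t::real. 1 - ln t) at_top (at_right 0)"
          by real_asymp
        then have "((\<lambda>t. (1 - ln t) powr (1 - e) / (e - 1)) \<longlongrightarrow> 0 / (e - 1)) (at_right 0)"
          using e by (intro tendsto_divide tendsto_neg_powr tendsto_const) auto
        moreover have "eventually (\<lambda>t. (1 - ln t) powr (1 - e) / (e - 1) = F t) (at_right 0)"
          by (auto simp: eventually_at_filter F_def)
        ultimately have "(F \<longlongrightarrow> 0 / (e - 1)) (at_right 0)"
          by (rule Lim_transform_eventually)
        then show ?thesis
          using True by (simp add: at_within_Icc_at_right F_def)
      next
        case False
        then have "0 < x" "x \<le> 1" using x by auto
        have "((\<lambda>t. (1 - ln t) powr (1 - e) / (e - 1)) \<longlongrightarrow> (1 - ln x) powr (1 - e) / (e - 1)) (at x)"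
          using \<open>0 < x\<close> e ln_less_1[OF \<open>0 < x\<close> \<open>x \<le> 1\<close>] by (intro tendsto_intros) auto
        moreover have "eventually (\<lambda>t. (1 - ln t) powr (1 - e) / (e - 1) = F t) (at x)"
          using order_tendstoD(1)[OF tendsto_ident_at \<open>0 < x\<close>]
          by eventually_elim (auto simp: F_def)
        ultimately have "(F \<longlongrightarrow> (1 - ln x) powr (1 - e) / (e - 1)) (at x)"
          by (rule Lim_transform_eventually)
        then have "(F \<longlongrightarrow> F x) (at x)"
          using \<open>0 < x\<close> by (simp add: F_def)
        then show ?thesis by (rule tendsto_within_subset) simp
      qed
    qed
    fix x :: real
    assume x: "x \<in> {0<..<1}"
    then have "0 < 1 - ln x" using ln_less_1[of x] by simp
    have "((\<lambda>t. 1 - ln t) has_real_derivative - (1 / x)) (at x)"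
      using x by (auto intro!: derivative_eq_intros)
    from DERIV_cdivide[OF DERIV_fun_powr[OF this \<open>0 < 1 - ln x\<close>, of "1 - e"], of "e - 1"]
    have "((\<lambda>t. (1 - ln t) powr (1 - e) / (e - 1)) has_real_derivative
      (1 - e) * (1 - ln x) powr (- e) * - (1 / x) / (e - 1)) (at x)" by simp
    also have "(1 - e) * (1 - ln x) powr (- e) * - (1 / x) / (e - 1) = 1 / x * (1 - ln x) powr (- e)"
    proof -
      have "(1 - e) * (1 - ln x) powr (- e) * - (1 / x) = (e - 1) * (1 / x * (1 - ln x) powr (- e))"
        using x by (simp add: field_simps)
      then show ?thesis using e by simp
    qed
    finally have "((\<lambda>t. (1 - ln t) powr (1 - e) / (e - 1)) has_real_derivative
      1 / x * (1 - ln x) powr (- e)) (at x)" .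
    moreover have "eventually (\<lambda>t. (1 - ln t) powr (1 - e) / (e - 1) = F t) (nhds x)"
    proof -
      have "eventually (\<lambda>t. t \<in> {0<..}) (nhds x)"
        using x by (intro eventually_nhds_in_open) auto
      then show ?thesis by eventually_elim (auto simp: F_def)
    qed
    ultimately have "(F has_real_derivative 1 / x * (1 - ln x) powr (- e)) (at x)"
      by (simp add: DERIV_cong_ev)
    then show "(F has_vector_derivative 1 / x * (1 - ln x) powr (- e)) (at x)"
      by (simp add: has_real_derivative_iff_has_vector_derivative)
  qed simp
  then have "((\<lambda>t. 1 / t * (1 - ln t) powr (- e)) has_integral (F 1 - F 0)) {0<..<1}"
    by (simp only: has_integral_Icc_iff_Ioo)
  then show ?thesis
    by (subst nn_integral_has_integral_lebesgue') auto
qed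

text \<open>
The primitive is $-\ln (1 - \ln t)$, unbounded near 0. The lower limit $s$ is chosen such that
$\ln (1 - \ln s) = M$, where $M - K$ exceeds the presumed finite value $C$ of the integral and $K$ is
the contribution of the upper limit.
\<close>

lemma nn_integral_log_weight_infinite:
  fixes d :: real
  assumes d: "0 < d" "d \<le> 1"
  shows "(\<integral>\<^sup>+t. ennreal (1 / (t * (1 - ln t))) * indicator {0<..<d} t \<partial>lborel) = top"
    (is "?I = _")
proof (rule ccontr)
  assume "?I \<noteq> top"
  then obtain C where C: "0 \<le> C" "?I = ennreal C"
    by (cases ?I) auto
  define K where "K = ln (1 - ln (d / 2))"
  define M where "M = max K (C + K + 1)"
  define s where "s = exp (1 - exp M)"
  have d2: "0 < d / 2" "d / 2 \<le> 1" using d by auto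
  have K: "exp K = 1 - ln (d / 2)"
    unfolding K_def using one_minus_ln_ge_1[OF d2] by (intro exp_ln) linarith
  have "exp K \<le> exp M" by (simp add: M_def)
  then have "ln s \<le> ln (d / 2)" using K by (simp add: s_def)
  moreover have "0 < s" by (simp add: s_def)
  ultimately have s: "0 < s" "s \<le> d / 2" using d2 by auto
  have "(\<integral>\<^sup>+t. ennreal (1 / (t * (1 - ln t))) * indicator {s..d / 2} t \<partial>lborel)
    = ennreal (- ln (1 - ln (d / 2)) - (- ln (1 - ln s)))"
  proof (rule nn_integral_FTC_Icc)
    show "(\<lambda>t::real. 1 / (t * (1 - ln t))) \<in> borel_measurable borel" by measurable
    fix x assume x: "x \<in> {s..d / 2}"
    then have x1: "0 < x" "x \<le> 1" "0 < 1 - ln x" using s d ln_less_1[of x] by auto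
    show "((\<lambda>t. - ln (1 - ln t)) has_real_derivative 1 / (x * (1 - ln x))) (at x)"
      using x1 by (auto intro!: derivative_eq_intros simp: field_simps)
    show "0 \<le> 1 / (x * (1 - ln x))" using x1 by simp
  qed (use s in simp)
  also have "- ln (1 - ln (d / 2)) - (- ln (1 - ln s)) = M - K"
    by (simp add: s_def K_def)
  finally have "ennreal (M - K)
    = (\<integral>\<^sup>+t. ennreal (1 / (t * (1 - ln t))) * indicator {s..d / 2} t \<partial>lborel)" ..
  also have "\<dots> \<le> ?I"
    using s d by (intro nn_integral_mono mult_left_mono) (auto simp: indicator_def)
  finally have "ennreal (M - K) \<le> ?I" .
  then have "M - K \<le> C" using C by simp
  then show False by (simp add: M_def)
qed

lemma critical_powr:
  assumes "0 < t" "t \<le> 1"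
  shows "critical p t powr r = t powr (- (r / p)) * (1 - ln t) powr (- (r / p))"
  using assms one_minus_ln_ge_1[of t] by (simp add: critical_def powr_powr powr_mult)

lemma critical_powr_p:
  assumes "0 < p" "0 < t" "t \<le> 1"
  shows "critical p t powr p = 1 / (t * (1 - ln t))"
  using assms x_one_minus_ln_pos[OF assms(2,3)] by (simp add: critical_def powr_powr powr_neg_one)

lemma critical_in_lorentz:
  assumes p: "0 < p" and q: "ennreal p < q"
  shows "critical p \<in> fspace (lorentz p q)"
proof (cases q)
  case top
  have "ennreal (t powr (1 / p)) * rearr (critical p) t \<le> 1" if t: "0 < t" for t
  proof (cases "t < 1")
    case True
    have "ennreal (t powr (1 / p)) * rearr (critical p) t
      \<le> ennreal (t powr (1 / p)) * ennreal (critical p t)"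
      by (intro mult_left_mono rearr_critical_le p t True) simp
    also have "\<dots> = ennreal ((1 - ln t) powr (- 1 / p))"
    proof -
      have "t powr (1 / p) * critical p t = t powr (1 / p) * t powr (- (1 / p)) * (1 - ln t) powr (- (1 / p))"
        using critical_powr[of t p 1] critical_pos[of t p] t True by simp
      also have "\<dots> = (1 - ln t) powr (- 1 / p)"
        using t by (simp flip: powr_add)
      finally show ?thesis by (simp flip: ennreal_mult')
    qed
    also have "\<dots> \<le> ennreal ((1 - ln t) powr 0)"
      using p one_minus_ln_ge_1[of t] t True by (intro ennreal_leI powr_mono) auto
    also have "\<dots> \<le> 1" using one_minus_ln_ge_1[of t] t True by simp
    finally show ?thesis .
  qed (simp add: rearr_eq_0)
  then have "lorentz p q (critical p) \<le> 1"
    unfolding lorentz_def using top by (auto intro: SUP_least)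
  then show ?thesis
    by (auto simp: fspace_def critical_borel intro: le_less_trans)
next
  case (real r)
  have pr: "p < r" and r: "0 < r" using q real p by (auto simp: ennreal_less_iff)
  have "lorentz_int p r (critical p)
    \<le> (\<integral>\<^sup>+t. ennreal (1 / t * (1 - ln t) powr (- (r / p))) * indicator {0<..<1} t \<partial>lborel)"
    unfolding lorentz_int_alt[OF r]
  proof (rule nn_integral_mono)
    fix t :: real
    consider "t \<le> 0" | "0 < t" "t < 1" | "1 \<le> t" by linarith
    then show "ennreal (t powr (r / p - 1)) * epowr (rearr (critical p) t) r * indicator {0<..} t
      \<le> ennreal (1 / t * (1 - ln t) powr (- (r / p))) * indicator {0<..<1} t"
    proof cases
      case 2
      have "epowr (rearr (critical p) t) r \<le> epowr (ennreal (critical p t)) r"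
        using rearr_critical_le[OF p 2] r by (intro epowr_mono) auto
      then have "ennreal (t powr (r / p - 1)) * epowr (rearr (critical p) t) r
        \<le> ennreal (t powr (r / p - 1)) * ennreal (critical p t powr r)"
        using critical_pos[of t p] 2 by (intro mult_left_mono) (auto simp: epowr_ennreal)
      also have "\<dots> = ennreal (1 / t * (1 - ln t) powr (- (r / p)))"
      proof -
        have "t powr (r / p - 1) * critical p t powr r
          = t powr (r / p - 1) * t powr (- (r / p)) * (1 - ln t) powr (- (r / p))"
          using critical_powr[of t p r] 2 by simp
        also have "t powr (r / p - 1) * t powr (- (r / p)) = 1 / t"
          using 2 by (simp add: powr_neg_one flip: powr_add)
        finally show ?thesis by (simp flip: ennreal_mult')
      qed
      finally show ?thesis using 2 by simp
    next
      case 3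
      then show ?thesis by (simp add: rearr_eq_0 epowr_def)
    qed simp
  qed
  also have "\<dots> < top"
    using pr p by (intro nn_integral_log_weight_finite) auto
  finally show ?thesis
    using real by (simp add: fspace_lorentz_iff[OF r] critical_borel)
qed

lemma nn_integral_unit_leb: "integral\<^sup>N unit_leb F = (\<integral>\<^sup>+x. F x * indicator {0<..<1} x \<partial>lborel)"
  by (subst nn_integral_restrict_space) (auto simp: nn_integral_completion)

text \<open>
If $A(s) \ge e s^p$ held for all large $s$, finiteness of the modular would put the critical function
into $L^p$ near 0, where its $p$-th power $1 / (t (1 - \ln t))$ is not integrable.
\<close>

lemma young_below_power:
  assumes p: "0 < p" and l: "0 < l" and A: "(\<integral>\<^sup>+x. A (ennreal (\<bar>critical p x\<bar> / l)) \<partial>unit_leb) \<le> 1"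
    and e: "0 < e"
  shows "\<exists>s\<ge>s0. 0 < s \<and> A (ennreal s) \<le> ennreal (e * s powr p)"
proof (rule ccontr)
  assume neg: "\<not> ?thesis"
  define M where "M = max s0 1"
  have above: "ennreal (e * s powr p) \<le> A (ennreal s)" if "M \<le> s" for s
  proof -
    have "s0 \<le> s" "0 < s" using that by (auto simp: M_def)
    then have "\<not> A (ennreal s) \<le> ennreal (e * s powr p)" using neg by blast
    then show ?thesis by simp
  qed
  have "((\<lambda>t::real. t * (1 - ln t)) \<longlongrightarrow> 0) (at_right 0)" by real_asymp
  then have "eventually (\<lambda>t::real. t * (1 - ln t) < (l * M) powr (- p)) (at_right 0)"
    using l by (intro order_tendstoD) (auto simp: M_def)
  then obtain b where b: "0 < b" "\<And>t. 0 < t \<Longrightarrow> t < b \<Longrightarrow> t * (1 - ln t) < (l * M) powr (- p)"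
    by (auto simp: eventually_at_right_field)
  define d where "d = min b 1"
  have d: "0 < d" "d \<le> 1" using b by (auto simp: d_def)
  have large: "M \<le> critical p t / l" if t: "0 < t" "t < d" for t
  proof -
    have "0 < t * (1 - ln t)" by (rule x_one_minus_ln_pos) (use t d in auto)
    then have "((l * M) powr (- p)) powr (- 1 / p) \<le> critical p t"
      unfolding critical_def using p b(2)[of t] t by (intro powr_mono2') (auto simp: d_def)
    also have "((l * M) powr (- p)) powr (- 1 / p) = l * M"
      using p l by (simp add: powr_powr M_def)
    finally show ?thesis using l by (simp add: field_simps)
  qed
  have "top = ennreal (e * l powr (- p)) * (\<integral>\<^sup>+t. ennreal (1 / (t * (1 - ln t))) * indicator {0<..<d} t \<partial>lborel)"
    using e l by (simp add: nn_integral_log_weight_infinite[OF d] ennreal_mult_top)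
  also have "\<dots> = (\<integral>\<^sup>+t. ennreal (e * l powr (- p)) * (ennreal (1 / (t * (1 - ln t))) * indicator {0<..<d} t) \<partial>lborel)"
    by (rule nn_integral_cmult[symmetric]) measurable
  also have "\<dots> \<le> (\<integral>\<^sup>+x. A (ennreal (\<bar>critical p x\<bar> / l)) * indicator {0<..<1} x \<partial>lborel)"
  proof (rule nn_integral_mono)
    fix t :: real
    show "ennreal (e * l powr (- p)) * (ennreal (1 / (t * (1 - ln t))) * indicator {0<..<d} t)
      \<le> A (ennreal (\<bar>critical p t\<bar> / l)) * indicator {0<..<1} t"
    proof (cases "t \<in> {0<..<d}")
      case True
      then have t: "0 < t" "t < d" "t \<le> 1" using d by auto
      have "ennreal (e * l powr (- p)) * ennreal (1 / (t * (1 - ln t)))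
        = ennreal (e * (critical p t / l) powr p)"
      proof -
        have "(critical p t / l) powr p = l powr (- p) * (1 / (t * (1 - ln t)))"
          using l critical_pos[of t p] t
          by (simp add: powr_divide powr_minus_divide critical_powr_p[OF p t(1,3)])
        then show ?thesis
          using e by (simp add: ennreal_mult'[symmetric] mult.assoc)
      qed
      also have "\<dots> \<le> A (ennreal (critical p t / l))"
        by (rule above[OF large[OF t(1,2)]])
      finally show ?thesis using t d critical_pos[of t p] by simp
    qed simp
  qed
  also have "\<dots> \<le> 1" using A by (simp add: nn_integral_unit_leb)
  finally show False by (simp add: top_unique)
qed

lemma level_measure_block:
  assumes "0 < s" "0 < m" "m \<le> 1"
  shows "level_measure (\<lambda>x. s * indicat_real {0<..<m} x) (s / 2) = m"
proof -
  have "{x \<in> space unit_leb. s / 2 < \<bar>s * indicat_real {0<..<m} x\<bar>} = {0<..<m}"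
    using assms by (auto simp: indicator_def split: if_splits)
  then show ?thesis
    using measure_unit_leb_Ioo[of m] assms by (simp add: level_measure_def)
qed

lemma block_borel: "m \<le> 1 \<Longrightarrow> (\<lambda>x. s * indicat_real {0<..<m} x) \<in> borel_measurable unit_leb"
  by (intro borel_measurable_times borel_measurable_const borel_measurable_indicator Ioo_sets_unit_leb)

text \<open>
The norm of a block is of the order $s\,m^{1/p}$ for every $q$: on $(0,m)$ its rearrangement is at
least $s/2$. The constant may depend on $p$ and $q$, so the halving, which provides a strict inequality
for the level sets, costs nothing.
\<close>

lemma lorentz_block_lower:
  assumes p: "0 < p" and q: "1 \<le> q"
  shows "\<exists>c>0. \<forall>s m. 0 < s \<longrightarrow> 0 < m \<longrightarrow> m \<le> 1 \<longrightarrow>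
    ennreal (c * (s * m powr (1 / p))) \<le> lorentz p q (\<lambda>x. s * indicat_real {0<..<m} x)"
proof (cases q)
  case top
  show ?thesis
  proof (intro exI conjI allI impI)
    show "0 < (1 / 2) powr (1 / p) / (2::real)" by simp
    fix s m :: real
    assume sm: "0 < s" "0 < m" "m \<le> 1"
    let ?g = "\<lambda>x. s * indicat_real {0<..<m} x"
    have "ennreal ((1 / 2) powr (1 / p) / 2 * (s * m powr (1 / p)))
      = ennreal ((m / 2) powr (1 / p)) * ennreal (s / 2)"
      using sm by (simp flip: ennreal_mult' add: powr_divide)
    also have "\<dots> \<le> ennreal ((m / 2) powr (1 / p)) * rearr ?g (m / 2)"
      using sm level_measure_block[OF sm]
      by (intro mult_left_mono le_rearr block_borel) auto
    also have "\<dots> \<le> lorentz p q ?g"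
      unfolding lorentz_def using top sm by (auto intro: SUP_upper)
    finally show "ennreal ((1 / 2) powr (1 / p) / 2 * (s * m powr (1 / p))) \<le> lorentz p q ?g" .
  qed
next
  case (real r)
  have r: "1 \<le> r" "0 < r" using q real by auto
  show ?thesis
  proof (intro exI conjI allI impI)
    show "0 < (p / r) powr (1 / r) / 2" using p r by simp
    fix s m :: real
    assume sm: "0 < s" "0 < m" "m \<le> 1"
    let ?g = "\<lambda>x. s * indicat_real {0<..<m} x"
    have "ennreal (p / r) * ennreal ((s / 2) powr r * m powr (r / p))
      = (\<integral>\<^sup>+t. ennreal (t powr (r / p - 1)) * (ennreal ((s / 2) powr r) * indicator {0<..<m} t) \<partial>lborel)"
      using p r sm by (intro nn_integral_powr_level[symmetric]) auto
    also have "\<dots> \<le> lorentz_int p r ?g"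
      unfolding lorentz_int_alt[OF r(2)]
    proof (rule nn_integral_mono)
      fix t :: real
      show "ennreal (t powr (r / p - 1)) * (ennreal ((s / 2) powr r) * indicator {0<..<m} t)
        \<le> ennreal (t powr (r / p - 1)) * epowr (rearr ?g t) r * indicator {0<..} t"
      proof (cases "t \<in> {0<..<m}")
        case True
        have "ennreal (s / 2) \<le> rearr ?g t"
          using True level_measure_block[OF sm] sm by (intro le_rearr block_borel) auto
        then have "epowr (ennreal (s / 2)) r \<le> epowr (rearr ?g t) r"
          using r by (intro epowr_mono) auto
        then show ?thesis
          using True sm by (auto simp: epowr_ennreal intro: mult_left_mono)
      qed simp
    qed
    finally have "epowr (ennreal (p / r) * ennreal ((s / 2) powr r * m powr (r / p))) (1 / r)
      \<le> lorentz p q ?g"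
      using r real by (simp add: lorentz_finite_index epowr_mono)
    also have "ennreal (p / r) * ennreal ((s / 2) powr r * m powr (r / p))
      = ennreal (p / r * ((s / 2) powr r * m powr (r / p)))"
      using p r by (intro ennreal_mult'[symmetric]) auto
    also have "epowr \<dots> (1 / r) = ennreal ((p / r * ((s / 2) powr r * m powr (r / p))) powr (1 / r))"
      using p r by (intro epowr_ennreal) auto
    also have "(p / r * ((s / 2) powr r * m powr (r / p))) powr (1 / r)
      = (p / r) powr (1 / r) / 2 * (s * m powr (1 / p))"
      using p r sm by (simp only: powr_mult powr_powr) (simp add: powr_powr)
    finally show "ennreal ((p / r) powr (1 / r) / 2 * (s * m powr (1 / p))) \<le> lorentz p q ?g" .
  qed
qed

text \<open>
The bound is assumed only for functions supported in some interval $(0,\delta)$, so that it follows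
from an almost-compact embedding as well as from a bounded one. The block of height $s$ on $(0,m)$ with
$m = 1/(e s^p)$ has modular $A(s) m \le 1$ and norm at least $c\,e^{-1/p} = c D > C$; large $s$ makes
the support as short as required.
\<close>

lemma no_local_bound:
  assumes p: "0 < p" and q: "1 \<le> q" and A0: "A 0 = 0" and crit: "critical p \<in> fspace (luxemburg A)"
    and \<delta>: "0 < \<delta>"
    and bound: "\<And>g. g \<in> borel_measurable unit_leb \<Longrightarrow> luxemburg A g \<le> 1 \<Longrightarrow>
      (\<And>x. x \<notin> {0<..<\<delta>} \<Longrightarrow> g x = 0) \<Longrightarrow> lorentz p q g \<le> ennreal C"
  shows False
proof -
  obtain l where l: "0 < l" "(\<integral>\<^sup>+x. A (ennreal (\<bar>critical p x\<bar> / l)) \<partial>unit_leb) \<le> 1"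
    using crit by (auto simp: fspace_def elim: luxemburg_finiteD)
  obtain c where c: "0 < c" "\<forall>s m. 0 < s \<longrightarrow> 0 < m \<longrightarrow> m \<le> 1 \<longrightarrow>
    ennreal (c * (s * m powr (1 / p))) \<le> lorentz p q (\<lambda>x. s * indicat_real {0<..<m} x)"
    using lorentz_block_lower[OF p q] by blast
  define D where "D = max C 0 / c + 1"
  have D: "0 < D" "C < c * D"
    using c by (auto simp: D_def field_simps add_pos_nonneg max_def)
  define e where "e = D powr (- p)"
  have e: "0 < e" using D by (simp add: e_def)
  define \<mu> where "\<mu> = min \<delta> 1"
  have \<mu>: "0 < \<mu>" "\<mu> \<le> \<delta>" "\<mu> \<le> 1" using \<delta> by (auto simp: \<mu>_def)
  define s0 where "s0 = (1 / (e * \<mu>)) powr (1 / p)"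
  obtain s where s: "s0 \<le> s" "0 < s" "A (ennreal s) \<le> ennreal (e * s powr p)"
    using young_below_power[OF p l e] by blast
  define m where "m = 1 / (e * s powr p)"
  have "1 / (e * \<mu>) = s0 powr p"
    using p e \<mu> by (simp add: s0_def powr_powr)
  also have "\<dots> \<le> s powr p"
    using s p by (intro powr_mono2) (auto simp: s0_def)
  finally have m: "0 < m" "m \<le> \<mu>"
    using e s \<mu> by (auto simp: m_def field_simps)
  let ?g = "\<lambda>x. s * indicat_real {0<..<m} x"
  have g: "?g \<in> borel_measurable unit_leb" using m \<mu> by (intro block_borel) auto
  have "(\<integral>\<^sup>+x. A (ennreal (\<bar>?g x\<bar> / 1)) \<partial>unit_leb)
    = (\<integral>\<^sup>+x. A (ennreal s) * indicator {0<..<m} x \<partial>unit_leb)"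
    using s A0 by (intro nn_integral_cong) (auto simp: indicator_def)
  also have "\<dots> = A (ennreal s) * ennreal m"
    using Ioo_sets_unit_leb[of m] m \<mu> measure_unit_leb_Ioo[of m]
    by (simp add: nn_integral_cmult_indicator finite_measure.emeasure_eq_measure[OF finite_unit_leb])
  also have "\<dots> \<le> ennreal (e * s powr p) * ennreal m"
    using s by (intro mult_right_mono) auto
  also have "\<dots> = 1"
    using e s by (simp flip: ennreal_mult' add: m_def)
  finally have "luxemburg A ?g \<le> ennreal 1"
    unfolding luxemburg_def by (intro Inf_lower imageI) auto
  then have "lorentz p q ?g \<le> ennreal C"
    using m \<mu> by (intro bound g) (auto simp: indicator_def)
  moreover have "s * m powr (1 / p) = D"
  proof -
    have "m = D powr p * s powr (- p)"
      by (simp add: m_def e_def powr_minus divide_inverse)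
    then have "m powr (1 / p) = D * s powr (- 1)"
      using p D s by (simp add: powr_mult powr_powr)
    then show ?thesis
      using s by (simp add: powr_neg_one)
  qed
  ultimately have "ennreal (c * D) \<le> ennreal C"
    using c(2) s m \<mu> by (metis order_trans)
  then show False
    using D mult_pos_pos[OF c(1) D(1)] by (auto simp: ennreal_le_iff2)
qed

lemma not_sub_diagonal_lorentz:
  assumes p: "0 < p" and q: "1 \<le> q" and pq: "ennreal p < q"
  shows "\<not> sub_diagonal (lorentz p q)" and "\<not> uniformly_sub_diagonal (lorentz p q)"
proof -
  have crit: "critical p \<in> fspace (lorentz p q)" by (rule critical_in_lorentz[OF p pq])
  show "\<not> sub_diagonal (lorentz p q)"
  proof
    assume "sub_diagonal (lorentz p q)"
    then obtain A where A: "young A" "embeds (luxemburg A) (lorentz p q)" "critical p \<in> fspace (luxemburg A)"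
      using crit unfolding sub_diagonal_def by blast
    obtain C :: real where C: "\<forall>f\<in>fspace (luxemburg A). lorentz p q f \<le> ennreal C * luxemburg A f"
      using A(2) unfolding embeds_def by blast
    show False
    proof (rule no_local_bound[OF p q _ A(3) zero_less_one])
      show "A 0 = 0" using A(1) by (simp add: young_def)
      fix g :: "real \<Rightarrow> real"
      assume g: "g \<in> borel_measurable unit_leb" "luxemburg A g \<le> 1"
      then have "g \<in> fspace (luxemburg A)" by (auto simp: fspace_def intro: le_less_trans)
      then have "lorentz p q g \<le> ennreal C * luxemburg A g" using C by blast
      also have "\<dots> \<le> ennreal C * 1" by (rule mult_left_mono[OF g(2)]) simp
      finally show "lorentz p q g \<le> ennreal C" by simp
    qed
  qed
  show "\<not> uniformly_sub_diagonal (lorentz p q)"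
  proof
    assume "uniformly_sub_diagonal (lorentz p q)"
    then obtain A where A: "young A" "embeds_ac (luxemburg A) (lorentz p q)" "critical p \<in> fspace (luxemburg A)"
      using crit unfolding uniformly_sub_diagonal_def by blast
    define E where "E n = {0<..<1 / real (Suc n)}" for n
    let ?F = "{h \<in> borel_measurable unit_leb. luxemburg A h \<le> 1}"
    have E: "E n \<in> sets unit_leb" for n
      unfolding E_def by (rule Ioo_sets_unit_leb) simp
    have "(\<lambda>n. indicat_real (E n) x) \<longlonglongrightarrow> 0" for x
    proof (rule tendsto_eventually)
      show "eventually (\<lambda>n. indicat_real (E n) x = 0) sequentially"
      proof (cases "0 < x")
        case True
        have "eventually (\<lambda>n. 1 / real (Suc n) < x) sequentially"
          using True by real_asymp
        then show ?thesis by eventually_elim (auto simp: E_def)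
      qed (auto simp: E_def)
    qed
    then have "(\<lambda>n. SUP h\<in>?F. lorentz p q (\<lambda>x. h x * indicat_real (E n) x)) \<longlonglongrightarrow> 0"
      using A(2) E unfolding embeds_ac_def by simp
    then have "eventually (\<lambda>n. (SUP h\<in>?F. lorentz p q (\<lambda>x. h x * indicat_real (E n) x)) < 1) sequentially"
      by (rule order_tendstoD) simp
    then obtain n where n: "(SUP h\<in>?F. lorentz p q (\<lambda>x. h x * indicat_real (E n) x)) < 1"
      by (auto simp: eventually_sequentially)
    show False
    proof (rule no_local_bound[OF p q _ A(3)])
      show "A 0 = 0" using A(1) by (simp add: young_def)
      show "0 < 1 / real (Suc n)" by simp
      fix g :: "real \<Rightarrow> real"
      assume g: "g \<in> borel_measurable unit_leb" "luxemburg A g \<le> 1"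
        and supp: "\<And>x. x \<notin> {0<..<1 / real (Suc n)} \<Longrightarrow> g x = 0"
      have "g = (\<lambda>x. g x * indicat_real (E n) x)"
      proof
        fix x
        show "g x = g x * indicat_real (E n) x"
        proof (cases "x \<in> E n")
          case False
          have "g x = 0" by (rule supp) (use False in \<open>simp only: E_def not_False_eq_True\<close>)
          then show ?thesis by simp
        qed simp
      qed
      moreover have "lorentz p q (\<lambda>x. g x * indicat_real (E n) x) < 1"
        by (rule le_less_trans[OF SUP_upper n]) (use g in auto)
      ultimately show "lorentz p q g \<le> ennreal 1" by simp
    qed
  qed
qed

theorem corollaryA13:
  fixes p :: real and q :: ennreal
  assumes "1 < p" and "1 \<le> q"
  shows "(sub_diagonal (lorentz p q) \<longleftrightarrow> uniformly_sub_diagonal (lorentz p q)) \<and>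
         (uniformly_sub_diagonal (lorentz p q) \<longleftrightarrow> q \<le> ennreal p)"
proof (cases "q \<le> ennreal p")
  case True
  then obtain r where r: "0 \<le> r" "q = ennreal r"
    by (cases q) (auto simp: top_unique)
  with True assms have "1 \<le> r" "r \<le> p"
    by (auto simp: ennreal_le_iff)
  then show ?thesis
    using sub_diagonal_lorentz True r by simp
next
  case False
  then have "ennreal p < q" by simp
  then show ?thesis
    using not_sub_diagonal_lorentz[of p q] assms False by simp
qed

end
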